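(* Let $X$ be a scattered compact (Hausdorff) space, and assume that for every subset $S$ of $X$ whose cardinality is regular there is $D\subseteq S$ such that $|D|=|S|$ and $D$ has a clopen strong Hausdorff system. (a) Suppose that there are unitary scattered compact spaces $L$ and $M$ and a family $\{L_i : i\in\omega\}$ of subsets of $X$ such that $M\prec L$ and, for every $i<j<\omega$, $L_i\approx L$ and $e^{L_i}\neq e^{L_j}$. Then $X$ is not a CO space. (b) Suppose that there are unitary scattered compact spaces $K,L,M$ such that $M\prec L\prec^{\mathrm{w}}K\subseteq X$. Then $X$ is not a CO space.
   Context: A space $X$ is a CO space if every closed subset of $X$ is homeomorphic to some clopen subset of $X$. A compact Hausdorff space is scattered if every nonempty subset has an isolated point in its relative topology. Cantor–Bendixson derivatives: $\mathrm{D}(X)$ is $X$ minus its isolated points, $\mathrm{D}_0(X)=X$, $\mathrm{D}_{\alpha+1}(X)=\mathrm{D}(\mathrm{D}_\alpha(X))$, $\mathrm{D}_\delta(X)=\bigcap_{\alpha<\delta}\mathrm{D}_\alpha(X)$ for limit $\delta$. For a scattered compact space $X$, $\mathrm{rk}(X)$ is the first ordinal $\alpha$ such that $\mathrm{D}_\alpha(X)$ is finite. A scattered compact space $X$ is unitary if $\mathrm{D}_{\mathrm{rk}(X)}(X)$ is a singleton; its unique element is denoted $e^X$. Subsets are given the subspace topology. Let $K,L$ be unitary scattered compact spaces. $K\approx L$ (almost homeomorphic) if there are clopen neighborhoods $U$ of $e^K$ in $K$ and $V$ of $e^L$ in $L$ with $U$ homeomorphic to $V$. $K\prec^{\mathrm{w}}L$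 if $K\not\approx L$ and there is a (unitary scattered compact) $K'\approx K$ with $K'\subseteq L$ and $e^{K'}=e^L$. $K\prec L$ if $K\not\approx L$, $\mathrm{rk}(K)=\mathrm{rk}(L)$, and there is $K'\approx K$ with $K'\subseteq L$. (Writing $L_i\approx L$ for a subset $L_i\subseteq X$ includes that $L_i$ is a unitary scattered compact space.) For $D\subseteq X$, a family $\{V_d : d\in D\}$, where each $V_d$ is an open neighborhood of $d$, is a strong Hausdorff system for $D$ if $V_d\cap V_e=\emptyset$ for all distinct $d,e\in D$ and $\mathrm{cl}(\bigcup_{d\in D}V_d)=\bigcup_{d\in D}\mathrm{cl}(V_d)\cup\mathrm{cl}(D)$; it is a clopen strong Hausdorff system if moreover every $V_d$ is clopen. *)

theory Defs
  imports "HOL-Analysis.Analysis"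
begin

unbundle cardinal_syntax

section \<open>CO spaces, scattered spaces, strong Hausdorff systems\<close>

definition clopenin :: "'a topology \<Rightarrow> 'a set \<Rightarrow> bool"
  where "clopenin X U \<longleftrightarrow> openin X U \<and> closedin X U"

definition CO_space :: "'a topology \<Rightarrow> bool"
  where "CO_space X \<longleftrightarrow>
    (\<forall>C. closedin X C \<longrightarrow>
      (\<exists>U. clopenin X U \<and> subtopology X C homeomorphic_space subtopology X U))"

definition scattered_compact :: "'a topology \<Rightarrow> bool"
  where "scattered_compact X \<longleftrightarrow> compact_space X \<and> Hausdorff_space X \<and>
    (\<forall>A \<subseteq> topspace X. A \<noteq> {} \<longrightarrow> (\<exists>a\<in>A. openin (subtopology X A) {a}))"

definition strong_Hausdorff_system :: "'a topology \<Rightarrow> 'a set \<Rightarrow> ('a \<Rightarrow> 'a set) \<Rightarrow> bool"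
  where "strong_Hausdorff_system X D V \<longleftrightarrow> D \<subseteq> topspace X \<and>
    (\<forall>d\<in>D. openin X (V d) \<and> d \<in> V d) \<and>
    (\<forall>d\<in>D. \<forall>e\<in>D. d \<noteq> e \<longrightarrow> V d \<inter> V e = {}) \<and>
    X closure_of (\<Union>d\<in>D. V d) = (\<Union>d\<in>D. X closure_of V d) \<union> X closure_of D"

definition clopen_strong_Hausdorff_system :: "'a topology \<Rightarrow> 'a set \<Rightarrow> ('a \<Rightarrow> 'a set) \<Rightarrow> bool"
  where "clopen_strong_Hausdorff_system X D V \<longleftrightarrow>
    strong_Hausdorff_system X D V \<and> (\<forall>d\<in>D. clopenin X (V d))"

section \<open>Cantor--Bendixson derivatives and rank\<close>

definition cb_derivative :: "'a topology \<Rightarrow> 'a set"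
  where "cb_derivative X = topspace X - {x \<in> topspace X. openin X {x}}"

text \<open>
  Ordinals are represented by the elements of a well-order \<open>r\<close>, an element \<open>i\<close> standing for
  the order type of its strict initial segment \<open>underS r i\<close>; the last branch below is thus
  the limit case.
\<close>

definition cb_iter :: "'o rel \<Rightarrow> 'a topology \<Rightarrow> 'o \<Rightarrow> 'a set"
  where "cb_iter r X = wo_rel.worec r (\<lambda>D i.
    if underS r i = {} then topspace X
    else if \<exists>j\<in>underS r i. i = wo_rel.suc r {j}
      then cb_derivative (subtopology X (D (THE j. j \<in> underS r i \<and> i = wo_rel.suc r {j})))
    else (\<Inter>j\<in>underS r i. D j))"

text \<open>
  The ordinals below the successor cardinal of the underlying type suffice to reach the rank
  of a scattered compact space (proved in \<open>cb_iter_finite\<close>).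
\<close>

definition ords :: "'a itself \<Rightarrow> 'a set rel"
  where "ords _ = cardSuc |UNIV :: 'a set|"

definition cb_rank :: "'a topology \<Rightarrow> 'a set"
  where "cb_rank X = wo_rel.minim (ords TYPE('a))
    {i \<in> Field (ords TYPE('a)). finite (cb_iter (ords TYPE('a)) X i)}"

text \<open>
  The rank as a well-order, so that ranks of spaces over different types can be compared
  by order isomorphism.
\<close>

definition cb_rank_ord :: "'a topology \<Rightarrow> 'a set rel"
  where "cb_rank_ord X = Restr (ords TYPE('a)) (underS (ords TYPE('a)) (cb_rank X))"

definition cb_last :: "'a topology \<Rightarrow> 'a set"
  where "cb_last X = cb_iter (ords TYPE('a)) X (cb_rank X)"

section \<open>Unitary spaces and their comparison\<close>

definition unitary :: "'a topology \<Rightarrow> bool"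
  where "unitary X \<longleftrightarrow> scattered_compact X \<and> (\<exists>e. cb_last X = {e})"

definition end_point :: "'a topology \<Rightarrow> 'a"
  where "end_point X = (THE e. cb_last X = {e})"

definition almost_homeomorphic :: "'a topology \<Rightarrow> 'b topology \<Rightarrow> bool"
  where "almost_homeomorphic K L \<longleftrightarrow> unitary K \<and> unitary L \<and>
    (\<exists>U V. clopenin K U \<and> end_point K \<in> U \<and> clopenin L V \<and> end_point L \<in> V \<and>
       subtopology K U homeomorphic_space subtopology L V)"

definition weakly_precedes :: "'a topology \<Rightarrow> 'b topology \<Rightarrow> bool"
  where "weakly_precedes K L \<longleftrightarrow> unitary K \<and> unitary L \<and> \<not> almost_homeomorphic K L \<and>
    (\<exists>K' \<subseteq> topspace L. almost_homeomorphic (subtopology L K') K \<and>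
       end_point (subtopology L K') = end_point L)"

definition precedes :: "'a topology \<Rightarrow> 'b topology \<Rightarrow> bool"
  where "precedes K L \<longleftrightarrow> unitary K \<and> unitary L \<and> \<not> almost_homeomorphic K L \<and>
    cb_rank_ord K =o cb_rank_ord L \<and>
    (\<exists>K' \<subseteq> topspace L. almost_homeomorphic (subtopology L K') K)"

section \<open>Well-definedness of the iterated derivatives and of the rank\<close>

context
  fixes r :: "'o rel"
  assumes wo: "Well_order r"
begin

interpretation wo_rel r
  using wo by (simp add: wo_rel_def)

lemma suc_above:
  assumes "j \<in> Field r" "k \<in> Field r" "(j, k) \<in> r" "j \<noteq> k"
  shows "(suc {j}, k) \<in> r" "j \<in> underS (suc {j})" "suc {j} \<in> Field r"
proof -
  have k: "k \<in> AboveS {j}"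
    using assms by (auto simp: Order_Relation.AboveS_def)
  then show "(suc {j}, k) \<in> r"
    by (rule suc_least_AboveS)
  have "suc {j} \<noteq> j \<and> (j, suc {j}) \<in> r"
    using k assms by (intro suc_greater) auto
  then show "j \<in> underS (suc {j})"
    by (auto simp: Order_Relation.underS_def)
  show "suc {j} \<in> Field r"
    using k assms by (intro suc_inField) auto
qed

lemma suc_inj:
  assumes "j \<in> underS i" "i = suc {j}" "k \<in> underS i" "i = suc {k}"
  shows "j = k"
proof -
  have *: "\<not> (a \<noteq> b \<and> (a, b) \<in> r)"
    if "i = suc {a}" "a \<in> underS i" "b \<in> underS i" for a b
  proof
    assume "a \<noteq> b \<and> (a, b) \<in> r"
    then have "(i, b) \<in> r"
      using that suc_above(1)[of a b] by (auto simp: Field_def)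
    with that show False
      using ANTISYM by (auto simp: Order_Relation.underS_def antisym_def)
  qed
  have "j \<in> Field r" "k \<in> Field r"
    using assms by (auto simp: Order_Relation.underS_def Field_def)
  then have "(j, k) \<in> r \<or> (k, j) \<in> r"
    using TOTALS by blast
  with *[of j k] *[of k j] assms show ?thesis
    by blast
qed

lemma the_pred:
  assumes "j \<in> underS i" "i = suc {j}"
  shows "(THE j. j \<in> underS i \<and> i = suc {j}) = j"
  using assms by (intro the_equality) (auto intro: suc_inj)

lemma cb_iter_unfold:
  "cb_iter r X i =
    (if underS i = {} then topspace X
     else if \<exists>j\<in>underS i. i = suc {j}
       then cb_derivative (subtopology X (cb_iter r X (THE j. j \<in> underS i \<and> i = suc {j})))
     else (\<Inter>j\<in>underS i. cb_iter r X j))"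
proof -
  define H where "H = (\<lambda>(D :: 'o \<Rightarrow> 'a set) i.
    if underS i = {} then topspace X
    else if \<exists>j\<in>underS i. i = suc {j}
      then cb_derivative (subtopology X (D (THE j. j \<in> underS i \<and> i = suc {j})))
    else (\<Inter>j\<in>underS i. D j))"
  have "H f i = H g i" if eq: "\<forall>j\<in>underS i. f j = g j" for f g i
  proof (cases "\<exists>j\<in>underS i. i = suc {j}")
    case True
    then obtain j where j: "j \<in> underS i" "i = suc {j}"
      by blast
    have "(THE j. j \<in> underS i \<and> i = suc {j}) \<in> underS i"
      using the_pred[OF j] j(1) by simp
    with eq True show ?thesis
      unfolding H_def by (auto cong: if_cong)
  next
    case False
    with eq show ?thesis
      unfolding H_def by (auto cong: if_cong)
  qed
  then have "adm_wo H"
    unfolding adm_wo_def by blast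
  from worec_fixpoint[OF this] have "worec H i = H (worec H) i"
    by (rule fun_cong)
  moreover have *: "cb_iter r X = worec H"
    unfolding cb_iter_def H_def ..
  ultimately have "cb_iter r X i = H (cb_iter r X) i"
    by (simp only: *)
  then show ?thesis
    unfolding H_def .
qed

lemma cb_iter_zero: "underS i = {} \<Longrightarrow> cb_iter r X i = topspace X"
  by (subst cb_iter_unfold) simp

lemma cb_iter_suc:
  assumes "j \<in> Field r" "k \<in> Field r" "(j, k) \<in> r" "j \<noteq> k"
  shows "cb_iter r X (suc {j}) = cb_derivative (subtopology X (cb_iter r X j))"
proof -
  have j: "j \<in> underS (suc {j})"
    by (rule suc_above(2)[OF assms])
  then have "underS (suc {j}) \<noteq> {}" "\<exists>k\<in>underS (suc {j}). suc {j} = suc {k}"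
    by auto
  with the_pred[OF j refl] show ?thesis
    by (subst cb_iter_unfold) simp
qed

lemma cb_iter_limit:
  assumes "underS i \<noteq> {}" "\<And>j. j \<in> underS i \<Longrightarrow> i \<noteq> suc {j}"
  shows "cb_iter r X i = (\<Inter>j\<in>underS i. cb_iter r X j)"
  using assms by (subst cb_iter_unfold) auto

lemma cb_iter_antimono:
  "(j, i) \<in> r \<Longrightarrow> cb_iter r X i \<subseteq> cb_iter r X j"
proof (induction i arbitrary: j rule: well_order_induct)
  case (1 i)
  show ?case
  proof (cases "j = i")
    case False
    then have j: "j \<in> underS i"
      using 1 by (auto simp: Order_Relation.underS_def)
    show ?thesis
    proof (cases "\<exists>k\<in>underS i. i = suc {k}")
      case True
      then obtain k where k: "k \<in> underS i" "i = suc {k}"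
        by blast
      have kF: "k \<in> Field r" "i \<in> Field r" "(k, i) \<in> r" "k \<noteq> i" "j \<in> Field r"
        using k(1) j by (auto simp: Order_Relation.underS_def Field_def)
      have "cb_iter r X i = cb_derivative (subtopology X (cb_iter r X k))"
        using cb_iter_suc[OF kF(1-4)] k(2) by simp
      then have ik: "cb_iter r X i \<subseteq> cb_iter r X k"
        by (auto simp: cb_derivative_def)
      have "(j, k) \<in> r"
      proof (rule ccontr)
        assume "(j, k) \<notin> r"
        then have "(k, j) \<in> r" "k \<noteq> j"
          using TOTALS kF REFL by (auto simp: refl_on_def)
        then have "(i, j) \<in> r"
          using suc_above(1)[of k j] kF k(2) by auto
        with j show False
          using ANTISYM by (auto simp: Order_Relation.underS_def antisym_def)
      qed
      with 1(1) kF ik show ?thesis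
        by blast
    next
      case False
      with j have "cb_iter r X i = (\<Inter>j\<in>underS i. cb_iter r X j)"
        by (intro cb_iter_limit) auto
      with j show ?thesis
        by auto
    qed
  qed simp
qed

lemma cb_iter_subset_topspace:
  assumes "i \<in> Field r"
  shows "cb_iter r X i \<subseteq> topspace X"
proof -
  define z where "z = minim (Field r)"
  have z: "z \<in> Field r"
    using assms minim_in[of "Field r"] unfolding z_def by blast
  have z_least: "(z, j) \<in> r" if "j \<in> Field r" for j
    using that minim_least[of "Field r" j] unfolding z_def by blast
  have "underS z = {}"
  proof (rule equals0I)
    fix y
    assume y: "y \<in> underS z"
    then have yz: "(y, z) \<in> r" "y \<noteq> z"
      by (simp_all add: Order_Relation.underS_def)
    then have "(z, y) \<in> r"
      by (intro z_least FieldI1)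
    with yz show False
      using antisymD[OF ANTISYM] by metis
  qed
  from cb_iter_zero[OF this] have "cb_iter r X z = topspace X" .
  with cb_iter_antimono[OF z_least[OF assms], of X] show ?thesis
    by simp
qed

end

lemma ords_card_order: "Card_order (ords TYPE('a))"
  unfolding ords_def by (rule cardSuc_Card_order[OF card_of_Card_order])

lemma ords_Well_order: "Well_order (ords TYPE('a))"
  by (rule card_order_on_well_order_on[OF ords_card_order])

lemma cb_iter_finite:
  fixes X :: "'a topology"
  assumes "scattered_compact X"
  shows "\<exists>i \<in> Field (ords TYPE('a)). finite (cb_iter (ords TYPE('a)) X i)"
proof (rule ccontr)
  let ?r = "ords TYPE('a)"
  let ?D = "cb_iter ?r X"
  assume "\<not> ?thesis"
  then have inf: "infinite (?D i)" if "i \<in> Field ?r" for i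
    using that by blast
  note wo = ords_Well_order[where 'a = 'a]
  interpret wo_rel ?r
    using wo by (simp add: wo_rel_def)
  have gt: "|UNIV :: 'a set| <o ?r"
    unfolding ords_def by (rule cardSuc_greater[OF card_of_Card_order])
  have "\<exists>p. p \<in> ?D i \<and> (\<forall>k \<in> Field ?r. (i, k) \<in> ?r \<longrightarrow> i \<noteq> k \<longrightarrow> p \<notin> ?D k)"
    if i: "i \<in> Field ?r" for i
  proof -
    have sub: "?D i \<subseteq> topspace X"
      by (rule cb_iter_subset_topspace[OF wo i])
    moreover have "?D i \<noteq> {}"
      using inf[OF i] by auto
    moreover have "\<forall>A \<subseteq> topspace X. A \<noteq> {} \<longrightarrow> (\<exists>a\<in>A. openin (subtopology X A) {a})"
      using assms unfolding scattered_compact_def by (elim conjE)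
    ultimately have "\<exists>p\<in>?D i. openin (subtopology X (?D i)) {p}"
      by (simp only: not_False_eq_True simp_thms)
    then obtain p where p: "p \<in> ?D i" "openin (subtopology X (?D i)) {p}"
      by (elim bexE)
    have "p \<notin> ?D k" if k: "k \<in> Field ?r" "(i, k) \<in> ?r" "i \<noteq> k" for k
    proof -
      have "?D k \<subseteq> ?D (suc {i})"
        by (rule cb_iter_antimono[OF wo suc_above(1)[OF wo i k]])
      also have "\<dots> = cb_derivative (subtopology X (?D i))"
        by (rule cb_iter_suc[OF wo i k])
      finally show ?thesis
        using p sub unfolding cb_derivative_def by auto
    qed
    with p show ?thesis
      by blast
  qed
  then have "\<forall>i \<in> Field ?r. \<exists>p. p \<in> ?D i \<and>
      (\<forall>k \<in> Field ?r. (i, k) \<in> ?r \<longrightarrow> i \<noteq> k \<longrightarrow> p \<notin> ?D k)"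
    by (intro ballI)
  from bchoice[OF this] obtain p where p': "\<forall>i \<in> Field ?r. p i \<in> ?D i \<and>
      (\<forall>k \<in> Field ?r. (i, k) \<in> ?r \<longrightarrow> i \<noteq> k \<longrightarrow> p i \<notin> ?D k)"
    by (elim exE)
  have p: "p i \<in> ?D i" if "i \<in> Field ?r" for i
    using p' that by blast
  have p2: "p i \<notin> ?D k" if "i \<in> Field ?r" "k \<in> Field ?r" "(i, k) \<in> ?r" "i \<noteq> k" for i k
    using p' that by blast
  have "inj_on p (Field ?r)"
  proof (rule inj_onI, rule ccontr)
    fix i k
    assume ik: "i \<in> Field ?r" "k \<in> Field ?r" "p i = p k" "i \<noteq> k"
    then consider "(i, k) \<in> ?r" | "(k, i) \<in> ?r"
      using TOTALS by blast
    then show False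
    proof cases
      case 1
      from p2[OF ik(1,2) 1 ik(4)] p[OF ik(2)] ik(3) show False
        by (simp only: simp_thms)
    next
      case 2
      from p2[OF ik(2,1) 2 ik(4)[symmetric]] p[OF ik(1)] ik(3) show False
        by (simp only: simp_thms)
    qed
  qed
  then have "|Field ?r| \<le>o |UNIV :: 'a set|"
    using card_of_ordLeq[of "Field ?r" "UNIV :: 'a set"] by blast
  then have "?r \<le>o |UNIV :: 'a set|"
    by (rule ordIso_ordLeq_trans[OF ordIso_symmetric[OF card_of_Field_ordIso[OF ords_card_order]]])
  with gt show False
    using not_ordLess_ordLeq by blast
qed

end

theory Submission
  imports Defs
begin

text \<open>
  Call a point \<open>d\<close> of type \<open>L\<close> if some neighbourhood of it looks like a neighbourhood of \<open>e\<^sup>L\<close> in \<open>L\<close>.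
  A \<^emph>\<open>system\<close> consists of points \<open>d\<close> of type \<open>L\<close> with disjoint clopen pieces around them that contain
  no other point of rank \<open>rk L\<close>, coloured by natural numbers, and a closed set \<open>A\<close> that lies in the
  closure of every colour class and closes the union of the pieces of any set of colours.
  Systems survive homeomorphic copying and, by the strong Hausdorff condition, can be merged.
  Let \<open>B\<^sub>i\<close> be the set of points lying in the \<open>i\<close>-th derivative of \<open>A\<close> for some system in \<open>X\<close>.
  If \<open>X\<close> is CO and \<open>B\<^sub>i \<noteq> {}\<close>, then \<open>B\<^sub>i\<close> is infinite: thinning the pieces of half of the colours
  to \<open>M\<close> gives a second type of limit point that still carries a system of full rank.
  Moreover some point of \<open>B\<^sub>i\<close> lies in no later \<open>B\<^sub>j\<close>. Hence, applying the hypothesis to countable sets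
  at successors and to sets of regular cardinality cofinal in \<open>i\<close> at limits, all \<open>B\<^sub>i\<close> are nonempty
  by induction, which is absurd because a late derivative of \<open>X\<close> is finite.
  Infinitely many copies of \<open>L\<close> with distinct ends start the induction with a convergent sequence.
\<close>

section \<open>Clopen bases of scattered compact spaces\<close>

text \<open>Two obstacles shape the construction. The strong Hausdorff hypothesis returns an
  unspecified subset of full size, so nothing may depend on which points survive: at a limit every
  subset of full size must still be cofinal, and the chosen points must be distinct, which is why
  each is taken outside all later sets. And a CO copy says nothing about where a closed set lands,
  so positions are recovered by counting: a copy maps a finite set of limit points injectively into
  itself and hence hits all of them. This needs one system that reaches all limit points at once,
  which is the reason for merging. That M and L have the same rank makes the two copies comparable:
  in the copy of the unthinned system a point of type M would have the rank of the system points,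
  hence be one of them and have type L as well, against M \<prec> L. Infinitely many colours are
  carried so that the untouched half is again a system, while the thinned half still accumulates at
  every point of A.\<close>

lemma scattered_compact_subtopology:
  assumes "scattered_compact X" "closedin X A"
  shows "scattered_compact (subtopology X A)"
  unfolding scattered_compact_def
proof (intro conjI allI impI)
  show "compact_space (subtopology X A)" "Hausdorff_space (subtopology X A)"
    using assms
    by (auto simp: scattered_compact_def Hausdorff_space_subtopology compact_space_subtopology closedin_compact_space)
next
  fix B assume "B \<subseteq> topspace (subtopology X A)" "B \<noteq> {}"
  moreover from this have "A \<inter> B = B" by auto
  ultimately show "\<exists>a\<in>B. openin (subtopology (subtopology X A) B) {a}"
    using assms(1) by (auto simp: scattered_compact_def subtopology_subtopology)
qed

text \<open>An isolated point of \<open>C\<close> is both open and closed in \<open>C\<close>, so a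
  connected \<open>C\<close> reduces to it.\<close>

lemma scattered_compact_connectedin:
  assumes "scattered_compact X" "connectedin X C" "x \<in> C" "y \<in> C"
  shows "x = y"
proof -
  have C: "C \<subseteq> topspace X" "C \<noteq> {}"
    using assms(2,3) connectedin_subset_topspace by auto
  then obtain a where a: "a \<in> C" "openin (subtopology X C) {a}"
    using assms(1) unfolding scattered_compact_def by blast
  have "closedin (subtopology X C) {a}"
    using assms(1) C(1) a(1)
    by (intro closedin_Hausdorff_finite) (auto simp: scattered_compact_def Hausdorff_space_subtopology)
  moreover have "connected_space (subtopology X C)"
    using assms(2) by (simp add: connectedin_def)
  ultimately have "{a} = topspace (subtopology X C)"
    using a(2) connected_space_clopen_in by blast
  then show ?thesis
    using assms(3,4) C(1) by (auto simp: inf_absorb2)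
qed

lemma clopenin_subset: "clopenin X U \<Longrightarrow> U \<subseteq> topspace X"
  by (simp add: clopenin_def openin_subset)

lemma clopenin_Int: "clopenin X U \<Longrightarrow> clopenin X V \<Longrightarrow> clopenin X (U \<inter> V)"
  by (auto simp: clopenin_def)

lemma clopenin_Diff: "clopenin X U \<Longrightarrow> clopenin X V \<Longrightarrow> clopenin X (U - V)"
  by (auto simp: clopenin_def)

lemma clopenin_subtopology:
  "clopenin X C \<Longrightarrow> clopenin (subtopology X C) U \<longleftrightarrow> clopenin X U \<and> U \<subseteq> C"
  by (auto simp: clopenin_def openin_open_subtopology closedin_closed_subtopology)

lemma clopenin_subtopology_Int: "clopenin X U \<Longrightarrow> clopenin (subtopology X S) (U \<inter> S)"
  unfolding clopenin_def by (meson closedin_subtopology openin_subtopology)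

lemma scattered_compact_clopen_base:
  assumes X: "scattered_compact X" and U: "openin X U" "x \<in> U"
  obtains W where "clopenin X W" "x \<in> W" "W \<subseteq> U"
proof -
  \<comment> \<open>In a compact Hausdorff space, closed sets that no connected set joins can be
    separated by clopen sets; here connected sets have at most one point.\<close>
  have "separated_between X {x} (topspace X - U)"
  proof (rule cut_wire_fence_theorem)
    show "disjnt C {x} \<or> disjnt C (topspace X - U)" if "connectedin X C" for C
      using scattered_compact_connectedin[OF X that] U(2) by (force simp: disjnt_iff)
    show "closedin X {x}"
      using X U openin_subset by (intro closedin_Hausdorff_finite) (auto simp: scattered_compact_def)
  qed (use X U in \<open>auto simp: scattered_compact_def\<close>)
  then obtain A B where "openin X A" "openin X B" "A \<union> B = topspace X" "disjnt A B" "{x} \<subseteq> A" "topspace X - U \<subseteq> B"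
    by (auto simp: separated_between_def)
  moreover from this have "A = topspace X - B" "A \<subseteq> U"
    using openin_subset[of X A] by (auto simp: disjnt_iff)
  ultimately show ?thesis
    using that[of A] by (auto simp: clopenin_def)
qed

lemma finite_disjoint_clopen:
  assumes X: "scattered_compact X" and B: "finite B" "B \<subseteq> topspace X"
  obtains W where "\<And>b. b \<in> B \<Longrightarrow> clopenin X (W b)" "\<And>b. b \<in> B \<Longrightarrow> b \<in> W b" 
    "disjoint_family_on W B"
proof -
  have "\<exists>U. clopenin X U \<and> b \<in> U \<and> U \<inter> B = {b}" if "b \<in> B" for b
  proof -
    have "openin X (topspace X - (B - {b}))"
      using X B by (intro openin_diff closedin_Hausdorff_finite) (auto simp: scattered_compact_def)
    then obtain U where "clopenin X U" "b \<in> U" "U \<subseteq> topspace X - (B - {b})"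
      using scattered_compact_clopen_base[OF X, of "topspace X - (B - {b})" b] \<open>b \<in> B\<close> B by blast
    with \<open>b \<in> B\<close> show ?thesis
      by (intro exI[of _ U]) auto
  qed
  then have "\<forall>b\<in>B. \<exists>U. clopenin X U \<and> b \<in> U \<and> U \<inter> B = {b}"
    by blast
  from bchoice[OF this] obtain U where U: "\<And>b. b \<in> B \<Longrightarrow> clopenin X (U b) \<and> b \<in> U b \<and> U b \<inter> B = {b}"
    by blast
  define W where "W b = U b - \<Union>(U ` (B - {b}))" for b
  show ?thesis
  proof (rule that[of W])
    fix b assume b: "b \<in> B"
    have "openin X (\<Union>(U ` (B - {b})))" "closedin X (\<Union>(U ` (B - {b})))"
      using U B(1) by (auto simp: clopenin_def intro!: closedin_Union)
    then show "clopenin X (W b)"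
      unfolding W_def using U[OF b] by (intro clopenin_Diff) (auto simp: clopenin_def)
    show "b \<in> W b"
    proof -
      have "b \<notin> U c" if "c \<in> B - {b}" for c
        using U[of c] that b by auto
      then show ?thesis
        unfolding W_def using U[OF b] by simp
    qed
  next
    show "disjoint_family_on W B"
      unfolding disjoint_family_on_def W_def by blast
  qed
qed

lemma homeomorphic_map_clopenin:
  assumes "homeomorphic_map X Y f" "clopenin X U"
  shows "clopenin Y (f ` U)"
  using assms homeomorphic_map_openness_eq homeomorphic_map_closedness_eq unfolding clopenin_def by blast

lemma homeomorphic_map_subset:
  assumes "homeomorphic_map X Y f" "A \<subseteq> topspace X"
  shows "homeomorphic_map (subtopology X A) (subtopology Y (f ` A)) f"
proof (rule homeomorphic_map_subtopologies[OF assms(1)])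
  show "f ` (topspace X \<inter> A) = topspace Y \<inter> f ` A"
    using assms homeomorphic_imp_surjective_map[OF assms(1)] by (auto simp: inf_absorb2)
qed

lemma homeomorphic_map_inverse:
  assumes "homeomorphic_map X Y f"
  obtains g where "homeomorphic_map Y X g" "\<And>x. x \<in> topspace X \<Longrightarrow> g (f x) = x" "\<And>y. y \<in> topspace Y \<Longrightarrow> f (g y) = y"
proof -
  obtain g where "homeomorphic_maps X Y f g"
    using assms by (auto simp: homeomorphic_map_maps)
  then show ?thesis
    using that[of g] by (auto simp: homeomorphic_maps_map)
qed

section \<open>Iterated derivatives\<close>

lemma derived_set_of_subtopology_open:
  assumes "openin X U"
  shows "U \<inter> X derived_set_of (U \<inter> S) = U \<inter> X derived_set_of S"
  using openin_Int_derived_set_of_eq[OF assms] by blast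

lemma cb_derivative_eq: "cb_derivative (subtopology X S) = topspace X \<inter> S \<inter> X derived_set_of S"
proof -
  have "cb_derivative (subtopology X S) = subtopology X S derived_set_of topspace (subtopology X S)"
    unfolding cb_derivative_def derived_set_of_topspace by auto
  also have "\<dots> = S \<inter> X derived_set_of (topspace X \<inter> S)"
    by (simp add: derived_set_of_subtopology Int_commute Int_left_commute)
  finally show ?thesis
    using derived_set_of_subset_topspace[of X S] by auto
qed

lemma underS_subset:
  assumes "Well_order r" "j \<in> underS r i"
  shows "underS r j \<subseteq> underS r i"
proof -
  interpret wo_rel r using assms by (simp add: wo_rel_def)
  show ?thesis
    using underS_incr[OF TRANS ANTISYM, of j i] assms(2) by (simp add: Order_Relation.underS_def)
qed

context
  fixes r :: "'o rel"
  assumes wo: "Well_order r"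
begin

interpretation wo_rel r
  using wo by (simp add: wo_rel_def)

lemma underS_Field': "j \<in> underS i \<Longrightarrow> j \<in> Field r"
  by (auto simp: Order_Relation.underS_def Field_def)

text \<open>One formula for the zero, successor and limit cases: a point of the space survives to
  stage \<open>i\<close> when every earlier stage accumulates at it. Later inductions over stages
  thereby avoid the case distinction.\<close>

lemma in_cb_iter:
  assumes i: "i \<in> Field r"
  shows "x \<in> cb_iter r X i \<longleftrightarrow> x \<in> topspace X \<and> (\<forall>j\<in>underS i. x \<in> X derived_set_of (cb_iter r X j))"
proof -
  have sub: "cb_iter r X i \<subseteq> topspace X" for i
    by (cases "i \<in> Field r")
       (auto simp: cb_iter_subset_topspace[OF wo] cb_iter_zero[OF wo] underS_empty)
  have *: "(i, j) \<in> r \<Longrightarrow> x \<in> cb_iter r X j \<Longrightarrow> x \<in> cb_iter r X i" for i j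
    using subsetD[OF cb_iter_antimono[OF wo, of i j X]] .
  have suc: "cb_iter r X (suc {j}) = cb_iter r X j \<inter> X derived_set_of (cb_iter r X j)"
    if "j \<in> underS i" for j i
  proof -
    have "j \<in> Field r" "i \<in> Field r" "(j, i) \<in> r" "j \<noteq> i"
      using that by (auto simp: Order_Relation.underS_def Field_def)
    from cb_iter_suc[OF wo this, of X] show ?thesis
      using sub[of j] by (auto simp: cb_derivative_eq)
  qed
  show ?thesis
  proof (cases "underS i = {}")
    case True
    then show ?thesis by (simp add: cb_iter_zero[OF wo])
  next
    case ne: False
    show ?thesis
    proof
      assume x: "x \<in> cb_iter r X i"
      show "x \<in> topspace X \<and> (\<forall>j\<in>underS i. x \<in> X derived_set_of (cb_iter r X j))"
      proof (intro conjI ballI)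
        show "x \<in> topspace X" using x sub by blast
        fix j assume j: "j \<in> underS i"
        then have "(suc {j}, i) \<in> r"
          by (intro suc_above(1)[OF wo]) (auto simp: Order_Relation.underS_def Field_def)
        from *[OF this x] suc[OF j] show "x \<in> X derived_set_of (cb_iter r X j)"
          by blast
      qed
    next
      assume R: "x \<in> topspace X \<and> (\<forall>j\<in>underS i. x \<in> X derived_set_of (cb_iter r X j))"
      show "x \<in> cb_iter r X i"
        using i ne R
      proof (induction i rule: well_order_induct)
        case (1 i)
        \<comment> \<open>The condition at \<open>i\<close> contains the condition at every earlier
          \<open>j\<close>, so the induction hypothesis puts \<open>x\<close> into all earlier
          stages.\<close>
        have under: "x \<in> cb_iter r X j" if j: "j \<in> underS i" for j
        proof (cases "underS j = {}")
          case True
          then show ?thesis using 1 by (simp add: cb_iter_zero[OF wo])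
        next
          case False
          have ji: "j \<in> Field r" "j \<noteq> i" "(j, i) \<in> r"
            using j by (auto simp: Order_Relation.underS_def Field_def)
          have "underS j \<subseteq> underS i"
            by (rule underS_subset[OF wo j])
          with 1 ji False show ?thesis
            by blast
        qed
        show ?case
        proof (cases "\<exists>j\<in>underS i. i = suc {j}")
          case True
          then obtain j where "j \<in> underS i" "i = suc {j}" by blast
          with suc[of j i] under 1 show ?thesis by auto
        next
          case False
          then have "cb_iter r X i = (\<Inter>j\<in>underS i. cb_iter r X j)"
            using 1 by (intro cb_iter_limit[OF wo]) auto
          with under show ?thesis by auto
        qed
      qed
    qed
  qed
qed

lemma cb_iter_subset: "i \<in> Field r \<Longrightarrow> cb_iter r X i \<subseteq> topspace X"
  by (rule cb_iter_subset_topspace[OF wo])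

lemma cb_iter_induct [consumes 1]:
  assumes "i \<in> Field r" "\<And>i. i \<in> Field r \<Longrightarrow> (\<And>j. j \<in> underS i \<Longrightarrow> P j) \<Longrightarrow> P i"
  shows "P i"
  using assms(1)
proof (induction i rule: well_order_induct)
  case (1 i)
  then show ?case
    using assms(2)[OF 1(2)] underS_Field' by (simp add: Order_Relation.underS_def)
qed

lemma cb_iter_mono:
  assumes "i \<in> Field r" "A \<subseteq> B"
  shows "cb_iter r (subtopology X A) i \<subseteq> cb_iter r (subtopology X B) i"
  using assms(1)
proof (induction rule: cb_iter_induct)
  case (1 i)
  show ?case
  proof
    fix x assume x: "x \<in> cb_iter r (subtopology X A) i"
    show "x \<in> cb_iter r (subtopology X B) i"
      unfolding in_cb_iter[OF 1(1)]
    proof (intro conjI ballI)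
      show "x \<in> topspace (subtopology X B)"
        using x assms(2) by (auto simp: in_cb_iter[OF 1(1)])
      fix j assume j: "j \<in> underS i"
      then have "x \<in> A \<inter> X derived_set_of (A \<inter> cb_iter r (subtopology X A) j)"
        using x by (simp add: in_cb_iter[OF 1(1)] derived_set_of_subtopology)
      moreover from 1(2)[OF j] assms(2) have "A \<inter> cb_iter r (subtopology X A) j \<subseteq> B \<inter> cb_iter r (subtopology X B) j"
        by auto
      then have "X derived_set_of (A \<inter> cb_iter r (subtopology X A) j) \<subseteq> X derived_set_of (B \<inter> cb_iter r (subtopology X B) j)"
        by (rule derived_set_of_mono)
      ultimately show "x \<in> subtopology X B derived_set_of cb_iter r (subtopology X B) j"
        using assms(2) unfolding derived_set_of_subtopology by blast
    qed
  qed
qed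

text \<open>Accumulation at a point of an open set is decided inside that set, so derivatives are
  local.\<close>

lemma cb_iter_open:
  assumes "i \<in> Field r" "openin X U"
  shows "cb_iter r (subtopology X U) i = U \<inter> cb_iter r X i"
  using assms(1)
proof (induction rule: cb_iter_induct)
  case (1 i)
  have "U \<inter> X derived_set_of (U \<inter> (U \<inter> S)) = U \<inter> X derived_set_of S" for S
    using derived_set_of_subtopology_open[OF assms(2), of S] by (simp add: Int_assoc[symmetric])
  then have "subtopology X U derived_set_of cb_iter r (subtopology X U) j
      = U \<inter> X derived_set_of (cb_iter r X j)" if "j \<in> underS i" for j
    using 1(2)[OF that] by (simp add: derived_set_of_subtopology)
  then show ?case
    using openin_subset[OF assms(2)] by (auto simp: in_cb_iter[OF 1(1)] )
qed

lemma cb_iter_derived: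
  assumes "i \<in> Field r" "j \<in> underS i" "x \<in> cb_iter r X i"
  shows "x \<in> X derived_set_of (cb_iter r X j)"
  using assms by (simp add: in_cb_iter)

end

text \<open>The two well-orders may live on different types: an order isomorphism of the initial
  segments below \<open>i\<close> and \<open>i'\<close> matches the two indices.\<close>

lemma cb_iter_homeomorphic:
  fixes r :: "'o rel" and r' :: "'p rel"
  assumes wo: "Well_order r" "Well_order r'" and h: "homeomorphic_map X Y h"
    and i: "i \<in> Field r" "i' \<in> Field r'"
    and iso: "Restr r (underS r i) =o Restr r' (underS r' i')"
  shows "cb_iter r' Y i' = h ` cb_iter r X i"
  using i iso
proof (induction arbitrary: i' rule: cb_iter_induct[OF wo(1), consumes 1])
  case (1 i)
  interpret r: wo_rel r using wo by (simp add: wo_rel_def)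
  interpret r': wo_rel r' using wo by (simp add: wo_rel_def)
  have h': "h ` topspace X = topspace Y"
    using h by (simp add: homeomorphic_imp_surjective_map)
  have inj: "inj_on h (topspace X)"
    using h by (simp add: homeomorphic_imp_injective_map)
  obtain f where f: "iso (Restr r (underS r i)) (Restr r' (underS r' i')) f"
    using 1(4) by (auto simp: ordIso_def)
  have F: "Field (Restr r (underS r i)) = underS r i" "Field (Restr r' (underS r' i')) = underS r' i'"
    using Field_Restr_ofilter[OF wo(1) r.underS_ofilter] Field_Restr_ofilter[OF wo(2) r'.underS_ofilter]
    by simp_all
  have bij: "bij_betw f (underS r i) (underS r' i')"
    using f unfolding iso_def F by simp
  have key: "cb_iter r' Y (f j) = h ` cb_iter r X j" if j: "j \<in> underS r i" for j
  proof (rule 1(2)[OF j])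
    show "f j \<in> Field r'"
      using bij j underS_Field'[OF wo(2)] bij_betwE by metis
    show "Restr r (underS r j) =o Restr r' (underS r' (f j))"
    proof -
      have ord: "(a, b) \<in> r \<longleftrightarrow> (f a, f b) \<in> r'" if "a \<in> underS r i" "b \<in> underS r i" for a b
        using f that bij unfolding iso_iff2 F bij_betw_def by auto
      have sub: "underS r j \<subseteq> underS r i" "underS r' (f j) \<subseteq> underS r' i'"
        using j bij underS_subset wo by (metis bij_betwE)+
      have "bij_betw f (underS r j) (underS r' (f j))"
        unfolding bij_betw_def
      proof
        show inj_j: "inj_on f (underS r j)"
          using bij sub inj_on_subset by (auto simp: bij_betw_def)
        show "f ` underS r j = underS r' (f j)"
        proof (intro equalityI subsetI)
          fix y assume "y \<in> f ` underS r j"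
          then obtain k where k: "k \<in> underS r j" "y = f k" by auto
          then have "f k \<noteq> f j"
            using bij j sub by (auto simp: bij_betw_def inj_on_def Order_Relation.underS_def)
          with k ord[of k j] sub j show "y \<in> underS r' (f j)"
            by (auto simp: Order_Relation.underS_def)
        next
          fix y assume y: "y \<in> underS r' (f j)"
          then obtain k where k: "k \<in> underS r i" "y = f k"
            using sub bij by (force simp: bij_betw_def)
          with y ord[of k j] j show "y \<in> f ` underS r j"
            by (auto simp: Order_Relation.underS_def)
        qed
      qed
      then have "iso (Restr r (underS r j)) (Restr r' (underS r' (f j))) f"
        using ord sub unfolding iso_iff2
          Field_Restr_ofilter[OF wo(1) r.underS_ofilter] Field_Restr_ofilter[OF wo(2) r'.underS_ofilter]
        by (auto simp: bij_betw_def)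
      then show ?thesis
        using wo by (auto simp: ordIso_def Well_order_Restr)
    qed
  qed
  show ?case
  proof -
    have "cb_iter r' Y i' = topspace Y \<inter> (\<Inter>j\<in>underS r i. Y derived_set_of (h ` cb_iter r X j))"
    proof -
      have "underS r' i' = f ` underS r i"
        using bij by (simp add: bij_betw_def)
      then show ?thesis
        using key by (auto simp: in_cb_iter[OF wo(2) 1(3)])
    qed
    also have "\<dots> = topspace Y \<inter> (\<Inter>j\<in>underS r i. h ` (X derived_set_of cb_iter r X j))"
      using homeomorphic_map_derived_set_of[OF h cb_iter_subset[OF wo(1) underS_Field'[OF wo(1)]]]
      by simp
    also have "\<dots> = h ` {x \<in> topspace X. \<forall>j\<in>underS r i. x \<in> X derived_set_of cb_iter r X j}"
    proof -
      have "y \<in> h ` {x \<in> topspace X. \<forall>j\<in>underS r i. x \<in> X derived_set_of cb_iter r X j}"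
        if y: "y \<in> topspace Y" and all: "\<And>j. j \<in> underS r i \<Longrightarrow> y \<in> h ` (X derived_set_of cb_iter r X j)" for y
      proof -
        obtain x where x: "x \<in> topspace X" "y = h x" using y h' by auto
        have "x \<in> X derived_set_of cb_iter r X j" if j: "j \<in> underS r i" for j
          using all[OF j] x inj derived_set_of_subset_topspace[of X] by (auto simp: inj_on_def)
        with x show ?thesis by auto
      qed
      then show ?thesis using h' by auto
    qed
    also have "\<dots> = h ` cb_iter r X i"
      using in_cb_iter[OF wo(1) 1(1), of _ X] by (intro arg_cong[where f="\<lambda>S. h ` S"]) auto
    finally show ?thesis .
  qed
qed

section \<open>Germs and ranks\<close>

text \<open>Pointed local homeomorphism type: an equivalence relation, also across types, that does
  not require unitary spaces. It allows \<open>L\<close> to be recognised at any point of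
  \<open>X\<close> and of its subspaces.\<close>

definition germ :: "'a topology \<Rightarrow> 'a \<Rightarrow> 'b topology \<Rightarrow> 'b \<Rightarrow> bool"
  where "germ X x Y y \<longleftrightarrow> (\<exists>U V f. openin X U \<and> x \<in> U \<and> openin Y V \<and>
    homeomorphic_map (subtopology X U) (subtopology Y V) f \<and> f x = y)"

lemma homeomorphic_map_subtopology_image:
  assumes "homeomorphic_map (subtopology X U) (subtopology Y V) f" "U \<subseteq> topspace X" "V \<subseteq> topspace Y" "A \<subseteq> U"
  shows "homeomorphic_map (subtopology X A) (subtopology Y (f ` A)) f" "f ` A \<subseteq> V"
proof -
  show *: "f ` A \<subseteq> V"
    using homeomorphic_imp_surjective_map[OF assms(1)] assms(2-4) by (auto simp: inf_absorb2)
  show "homeomorphic_map (subtopology X A) (subtopology Y (f ` A)) f"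
    using homeomorphic_map_subset[OF assms(1), of A] * assms(2-4)
    by (simp add: subtopology_subtopology inf_absorb2)
qed

lemma homeomorphic_map_subtopology_open:
  assumes "homeomorphic_map (subtopology X U) (subtopology Y V) f" "openin X U" "openin Y V" 
    "openin X A" "A \<subseteq> U"
  shows "openin Y (f ` A)"
proof -
  have "openin (subtopology X U) A"
    using assms by (simp add: openin_open_subtopology)
  then have "openin (subtopology Y V) (f ` A)"
    using homeomorphic_map_openness_eq[OF assms(1)] by blast
  then show ?thesis
    using assms(3) openin_trans_full by blast
qed

lemma germE:
  assumes "germ X x Y y" "openin X N" "x \<in> N"
  obtains U V f where "openin X U" "x \<in> U" "U \<subseteq> N" "openin Y V" "y \<in> V"
    "homeomorphic_map (subtopology X U) (subtopology Y V) f" "f x = y"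
proof -
  obtain U V f where f: "openin X U" "x \<in> U" "openin Y V"
    "homeomorphic_map (subtopology X U) (subtopology Y V) f" "f x = y"
    using assms(1) unfolding germ_def by blast
  have U: "openin X (U \<inter> N)" using f assms by auto
  have "openin Y (f ` (U \<inter> N))"
    by (rule homeomorphic_map_subtopology_open[OF f(4,1,3) U]) simp
  moreover have "homeomorphic_map (subtopology X (U \<inter> N)) (subtopology Y (f ` (U \<inter> N))) f"
    by (rule homeomorphic_map_subtopology_image(1)[OF f(4)]) (use f in \<open>auto simp: openin_subset\<close>)
  ultimately show ?thesis
    using that[of "U \<inter> N" "f ` (U \<inter> N)" f] U f assms by auto
qed

lemma germ_topspace:
  assumes "germ X x Y y"
  shows "x \<in> topspace X" "y \<in> topspace Y"
proof -
  show x: "x \<in> topspace X"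
    using assms openin_subset unfolding germ_def by fast
  obtain V where "openin Y V" "y \<in> V"
    using germE[OF assms openin_topspace x] by metis
  then show "y \<in> topspace Y"
    using openin_subset[of Y V] by auto
qed

lemma germ_sym:
  assumes "germ X x Y y" shows "germ Y y X x"
proof -
  obtain U V f where f: "openin X U" "x \<in> U" "openin Y V" "y \<in> V"
    "homeomorphic_map (subtopology X U) (subtopology Y V) f" "f x = y"
    by (rule germE[OF assms openin_topspace germ_topspace(1)[OF assms]])
  obtain g where "homeomorphic_map (subtopology Y V) (subtopology X U) g"
    "\<And>x. x \<in> topspace (subtopology X U) \<Longrightarrow> g (f x) = x"
    by (rule homeomorphic_map_inverse[OF f(5)]) (rule that)
  with f show ?thesis
    unfolding germ_def using openin_subset[OF f(1)]
    by (intro exI[of _ V] exI[of _ U] exI[of _ g]) auto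
qed

lemma germ_trans:
  assumes "germ X x Y y" "germ Y y Z z"
  shows "germ X x Z z"
proof -
  obtain V U f where f: "openin Y V" "y \<in> V" "openin X U" "x \<in> U"
    "homeomorphic_map (subtopology Y V) (subtopology X U) f" "f y = x"
    by (rule germE[OF germ_sym[OF assms(1)] openin_topspace germ_topspace(2)[OF assms(1)]])
  obtain V' W g where g: "openin Y V'" "y \<in> V'" "V' \<subseteq> V" "openin Z W" "z \<in> W"
    "homeomorphic_map (subtopology Y V') (subtopology Z W) g" "g y = z"
    by (rule germE[OF assms(2) f(1,2)])
  note sub = openin_subset[OF f(1)] openin_subset[OF f(3)] openin_subset[OF g(1)]
  have f': "homeomorphic_map (subtopology Y V') (subtopology X (f ` V')) f"
    by (rule homeomorphic_map_subtopology_image[OF f(5) sub(1,2) g(3)])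
  then obtain h where h: "homeomorphic_map (subtopology X (f ` V')) (subtopology Y V') h"
    "\<And>x. x \<in> topspace (subtopology Y V') \<Longrightarrow> h (f x) = x"
    by (rule homeomorphic_map_inverse) (rule that)
  have "homeomorphic_map (subtopology X (f ` V')) (subtopology Z W) (g \<circ> h)"
    using h(1) g(6) by (rule homeomorphic_map_compose)
  moreover have "openin X (f ` V')"
    by (rule homeomorphic_map_subtopology_open[OF f(5,1,3) g(1,3)])
  moreover have "(g \<circ> h) x = z"
    using h(2)[of y] f(6) g(2,7) sub by auto
  ultimately show ?thesis
    unfolding germ_def using f(6) g(2,4) by (intro exI[of _ "f ` V'"] exI[of _ W] exI[of _ "g \<circ> h"]) auto
qed

lemma germ_homeomorphic_map:
  assumes "homeomorphic_map X Y f" "x \<in> topspace X"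
  shows "germ X x Y (f x)"
  unfolding germ_def using assms
  by (intro exI[of _ "topspace X"] exI[of _ "topspace Y"] exI[of _ f]) simp

lemma germ_open:
  assumes "openin X U" "x \<in> U"
  shows "germ (subtopology X U) x X x"
proof -
  have "openin (subtopology X U) U"
    using assms by (simp add: openin_open_subtopology)
  moreover have "homeomorphic_map (subtopology (subtopology X U) U) (subtopology X U) id"
    by (simp add: subtopology_subtopology)
  ultimately show ?thesis
    unfolding germ_def using assms by (intro exI[of _ U] exI[of _ id]) auto
qed

lemma germ_open_subtopology:
  assumes "openin (subtopology X B) A" "x \<in> A"
  shows "germ (subtopology X A) x (subtopology X B) x"
proof -
  have "subtopology (subtopology X B) A = subtopology X A"
    using openin_imp_subset[OF assms(1)] by (simp add: subtopology_subtopology inf_absorb2)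
  with germ_open[OF assms] show ?thesis by simp
qed

text \<open>Derivatives are local and invariant under homeomorphism. The second claim, phrased with
  derived sets, tells whether the point is isolated in its stage without naming a successor
  index.\<close>

lemma germ_cb_iter:
  fixes r :: "'o rel" and r' :: "'p rel"
  assumes wo: "Well_order r" "Well_order r'" and g: "germ X x Y y"
    and i: "i \<in> Field r" "i' \<in> Field r'"
    and iso: "Restr r (underS r i) =o Restr r' (underS r' i')"
  shows "x \<in> cb_iter r X i \<longleftrightarrow> y \<in> cb_iter r' Y i'"
    and "x \<in> X derived_set_of (cb_iter r X i) \<longleftrightarrow> y \<in> Y derived_set_of (cb_iter r' Y i')"
proof -
  obtain U V f where f: "openin X U" "x \<in> U" "openin Y V" "y \<in> V"
    "homeomorphic_map (subtopology X U) (subtopology Y V) f" "f x = y"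
    by (rule germE[OF g openin_topspace germ_topspace(1)[OF g]])
  have eq: "V \<inter> cb_iter r' Y i' = f ` (U \<inter> cb_iter r X i)"
    using cb_iter_homeomorphic[OF wo f(5) i iso] cb_iter_open[OF wo(1) i(1) f(1)] cb_iter_open[OF wo(2) i(2) f(3)]
    by simp
  have inj: "inj_on f U"
    using homeomorphic_imp_injective_map[OF f(5)] openin_subset[OF f(1)] by (simp add: inf_absorb2)
  have mem: "f x \<in> f ` (U \<inter> S) \<longleftrightarrow> x \<in> S" for S
    using inj_on_image_mem_iff[OF inj f(2), of "U \<inter> S"] f(2) by simp
  show "x \<in> cb_iter r X i \<longleftrightarrow> y \<in> cb_iter r' Y i'"
    using mem[of "cb_iter r X i"] f(4) unfolding eq[symmetric] f(6) by simp
  have "U \<inter> cb_iter r X i \<subseteq> topspace (subtopology X U)"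
    using openin_subset[OF f(1)] by auto
  from homeomorphic_map_derived_set_of[OF f(5) this]
  have "subtopology Y V derived_set_of (V \<inter> cb_iter r' Y i') = f ` (subtopology X U derived_set_of (U \<inter> cb_iter r X i))"
    by (simp add: eq)
  then have "V \<inter> Y derived_set_of (cb_iter r' Y i') = f ` (U \<inter> X derived_set_of (cb_iter r X i))"
    by (simp add: derived_set_of_subtopology derived_set_of_subtopology_open[OF f(1)] derived_set_of_subtopology_open[OF f(3)])
  from mem[of "X derived_set_of (cb_iter r X i)", folded this]
  show "x \<in> X derived_set_of (cb_iter r X i) \<longleftrightarrow> y \<in> Y derived_set_of (cb_iter r' Y i')"
    using f(4) unfolding f(6) by simp
qed

section \<open>Ranks read off from germs\<close>

lemma Restr_underS_Well_order: "Well_order r \<Longrightarrow> Well_order (Restr r (underS r i))"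
  by (rule Well_order_Restr)

text \<open>Were the segment below \<open>i'\<close> longer, the one below \<open>i\<close> would be
  isomorphic to the segment below some \<open>b\<close> before \<open>i'\<close>; stage
  \<open>b\<close> accumulates at \<open>y\<close>, hence stage \<open>i\<close> at
  \<open>x\<close>.\<close>

lemma germ_rank_le:
  fixes r :: "'o rel" and r' :: "'p rel"
  assumes wo: "Well_order r" "Well_order r'" and g: "germ X x Y y"
    and i: "i \<in> Field r" "i' \<in> Field r'"
    and x: "x \<notin> X derived_set_of (cb_iter r X i)" and y: "y \<in> cb_iter r' Y i'"
  shows "Restr r' (underS r' i') \<le>o Restr r (underS r i)"
proof (rule ccontr)
  interpret r': wo_rel r' using wo by (simp add: wo_rel_def)
  let ?r' = "Restr r' (underS r' i')"
  assume "\<not> ?thesis"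
  then have "Restr r (underS r i) <o ?r'"
    using not_ordLeq_iff_ordLess[OF Restr_underS_Well_order[OF wo(1), of i] Restr_underS_Well_order[OF wo(2), of i']] by simp
  then obtain b where b: "b \<in> Field ?r'" "Restr r (underS r i) =o Restr ?r' (underS ?r' b)"
    using ordLess_iff_ordIso_Restr[OF Restr_underS_Well_order[OF wo(2), of i'] Restr_underS_Well_order[OF wo(1), of i]] by auto
  have b': "b \<in> underS r' i'"
    using b(1) Field_Restr_ofilter[OF wo(2) r'.underS_ofilter, of i'] by simp
  have sub: "underS r' b \<subseteq> underS r' i'"
    by (rule underS_subset[OF wo(2) b'])
  have "underS ?r' b = underS r' b"
    using b' sub by (auto simp: Order_Relation.underS_def)
  then have "Restr ?r' (underS ?r' b) = Restr r' (underS r' b)"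
    using sub by auto
  with b(2) have "Restr r (underS r i) =o Restr r' (underS r' b)" by simp
  from germ_cb_iter(2)[OF wo g i(1) underS_Field'[OF wo(2) b'] this] x
  have "y \<notin> Y derived_set_of (cb_iter r' Y b)" by simp
  with cb_iter_derived[OF wo(2) i(2) b' y] show False by simp
qed

text \<open>Isomorphic initial segments of one well-order coincide, so a rank known up to
  isomorphism determines its index.\<close>

lemma Restr_underS_eq:
  assumes wo: "Well_order r" and i: "i \<in> Field r" "j \<in> Field r"
    and le: "Restr r (underS r i) =o Restr r (underS r j)"
  shows "i = j"
proof -
  interpret wo: wo_rel r using wo by (simp add: wo_rel_def)
  have "underS r i \<subseteq> underS r j" "underS r j \<subseteq> underS r i"
    using le ofilter_subset_ordLeq[OF wo wo.underS_ofilter wo.underS_ofilter] ordIso_iff_ordLeq by blast+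
  then have "underS r i = underS r j" by blast
  show ?thesis
  proof (rule ccontr)
    assume "i \<noteq> j"
    then have "i \<in> underS r j \<or> j \<in> underS r i"
      using wo.TOTALS i by (auto simp: Order_Relation.underS_def)
    with \<open>underS r i = underS r j\<close> show False
      by (auto simp: Order_Relation.underS_def)
  qed
qed

lemma cb_rank_in: 
  fixes X :: "'a topology"
  assumes "scattered_compact X"
  shows "cb_rank X \<in> Field (ords TYPE('a))"
proof -
  interpret wo_rel "ords TYPE('a)" using ords_Well_order by (simp add: wo_rel_def)
  have "cb_rank X \<in> {i \<in> Field (ords TYPE('a)). finite (cb_iter (ords TYPE('a)) X i)}"
    unfolding cb_rank_def using cb_iter_finite[OF assms] by (intro minim_in) auto
  then show ?thesis by blast
qed

lemma unitary_cb_iter: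
  fixes X :: "'a topology"
  assumes "unitary X"
  shows "cb_iter (ords TYPE('a)) X (cb_rank X) = {end_point X}" "end_point X \<in> topspace X"
    "cb_rank X \<in> Field (ords TYPE('a))" "scattered_compact X"
    "X derived_set_of (cb_iter (ords TYPE('a)) X (cb_rank X)) = {}"
proof -
  obtain e where e: "cb_last X = {e}" and X: "scattered_compact X"
    using assms by (auto simp: unitary_def)
  then have "end_point X = e"
    by (simp add: end_point_def)
  with e show eq: "cb_iter (ords TYPE('a)) X (cb_rank X) = {end_point X}"
    by (simp add: cb_last_def)
  show "scattered_compact X" by fact
  show F: "cb_rank X \<in> Field (ords TYPE('a))" by (rule cb_rank_in[OF X])
  show "end_point X \<in> topspace X"
    using cb_iter_subset[OF ords_Well_order F, of X] eq by blast
  show "X derived_set_of (cb_iter (ords TYPE('a)) X (cb_rank X)) = {}"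
    using X unfolding eq by (simp add: scattered_compact_def derived_set_of_singleton)
qed

text \<open>The homeomorphism of neighbourhoods is not assumed to match the two ends. Each rank
  bounds the other because either end corresponds to some point of the other space; once the ranks
  agree, the end of \<open>K\<close> goes into the last stage of \<open>L\<close>, which has a
  single point.\<close>

lemma almost_homeomorphic_germ:
  fixes K :: "'a topology" and L :: "'b topology"
  assumes "almost_homeomorphic K L"
  shows "germ K (end_point K) L (end_point L)" "cb_rank_ord K =o cb_rank_ord L"
proof -
  let ?r = "ords TYPE('a)" and ?r' = "ords TYPE('b)"
  obtain U V f where K: "unitary K" and L: "unitary L"
    and f: "openin K U" "end_point K \<in> U" "openin L V" "end_point L \<in> V"
      "homeomorphic_map (subtopology K U) (subtopology L V) f"
    using assms by (auto simp: almost_homeomorphic_def clopenin_def homeomorphic_space)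
  note K' = unitary_cb_iter[OF K] and L' = unitary_cb_iter[OF L]
  have g: "germ K x L (f x)" if "x \<in> U" for x
    unfolding germ_def using f that by auto
  obtain x where x: "x \<in> U" "f x = end_point L"
    using homeomorphic_imp_surjective_map[OF f(5)] f(4) openin_subset[OF f(1)] openin_subset[OF f(3)]
    by (auto simp: inf_absorb2)
  have "Restr ?r' (underS ?r' (cb_rank L)) \<le>o Restr ?r (underS ?r (cb_rank K))"
    using K'(5) L'(1) x by (intro germ_rank_le[OF ords_Well_order ords_Well_order g[OF x(1)] K'(3) L'(3)]) auto
  moreover have "Restr ?r (underS ?r (cb_rank K)) \<le>o Restr ?r' (underS ?r' (cb_rank L))"
    using L'(5) K'(1) by (intro germ_rank_le[OF ords_Well_order ords_Well_order germ_sym[OF g[OF f(2)]] L'(3) K'(3)]) auto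
  ultimately have iso: "Restr ?r (underS ?r (cb_rank K)) =o Restr ?r' (underS ?r' (cb_rank L))"
    by (simp add: ordIso_iff_ordLeq)
  then show "cb_rank_ord K =o cb_rank_ord L"
    by (simp add: cb_rank_ord_def)
  have "f (end_point K) \<in> cb_iter ?r' L (cb_rank L)"
    using germ_cb_iter(1)[OF ords_Well_order ords_Well_order g[OF f(2)] K'(3) L'(3) iso] K'(1) by simp
  then show "germ K (end_point K) L (end_point L)"
    using g[OF f(2)] L'(1) by simp
qed

lemma germ_clopenE:
  assumes "germ X x Y y" "scattered_compact X" "scattered_compact Y" "openin X N" "x \<in> N"
  obtains U V f where "clopenin X U" "x \<in> U" "U \<subseteq> N" "clopenin Y V" "y \<in> V"
    "homeomorphic_map (subtopology X U) (subtopology Y V) f" "f x = y"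
proof -
  obtain U V f where f: "openin X U" "x \<in> U" "U \<subseteq> N" "openin Y V" "y \<in> V"
    "homeomorphic_map (subtopology X U) (subtopology Y V) f" "f x = y"
    by (rule germE[OF assms(1,4,5)])
  obtain W where W: "clopenin X W" "x \<in> W" "W \<subseteq> U"
    by (rule scattered_compact_clopen_base[OF assms(2) f(1,2)])
  have h: "homeomorphic_map (subtopology X W) (subtopology Y (f ` W)) f"
    by (rule homeomorphic_map_subtopology_image[OF f(6) openin_subset[OF f(1)] openin_subset[OF f(4)] W(3)])
  have o: "openin Y (f ` W)"
    by (rule homeomorphic_map_subtopology_open[OF f(6) f(1) f(4) _ W(3)]) (use W in \<open>simp add: clopenin_def\<close>)
  \<comment> \<open>As \<open>V\<close> is merely open, \<open>f\<close> alone does not show that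
    the image of \<open>W\<close> is closed in \<open>Y\<close>; compactness does.\<close>
  have "compact_space (subtopology X W)"
    using assms(2) W(1) by (auto simp: scattered_compact_def clopenin_def compact_space_subtopology closedin_compact_space)
  then have "compact_space (subtopology Y (f ` W))"
    using h homeomorphic_map_imp_homeomorphic_space homeomorphic_compact_space by blast
  then have "compactin Y (f ` W)"
    using openin_subset[OF o] by (simp add: compactin_subspace)
  then have "clopenin Y (f ` W)"
    using o assms(3) compactin_imp_closedin by (auto simp: clopenin_def scattered_compact_def)
  with W f h show ?thesis
    by (intro that[of W "f ` W" f]) auto
qed

lemma germ_almost_homeomorphic:
  assumes "unitary K" "unitary L" "germ K (end_point K) L (end_point L)"
  shows "almost_homeomorphic K L"
  using germ_clopenE[OF assms(3) unitary_cb_iter(4)[OF assms(1)] unitary_cb_iter(4)[OF assms(2)] openin_topspace unitary_cb_iter(2)[OF assms(1)]] assms(1,2)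
  unfolding almost_homeomorphic_def homeomorphic_space by metis

section \<open>Systems of points of one type\<close>

abbreviation cb_level :: "'a topology \<Rightarrow> 'a set \<Rightarrow> 'a set"
  where "cb_level X i \<equiv> cb_iter (ords TYPE('a)) X i"

lemma in_closure_of_Int_open:
  "openin X U \<Longrightarrow> x \<in> U \<Longrightarrow> x \<in> X closure_of S \<Longrightarrow> x \<in> X closure_of (S \<inter> U)"
  using openin_Int_closure_of_subset[of X U S] by (auto simp: Int_commute)

text \<open>Inside \<open>V e\<close> only \<open>S e\<close> matters, because the other sets lie in
  members disjoint from \<open>V e\<close>; by \<open>cl\<close>, the remaining closure points
  belong to the closure of \<open>E\<close>. This is how the strong Hausdorff condition turns local
  closed sets into a global one.\<close>

lemma closedin_merge:
  assumes V: "\<And>e. e \<in> E \<Longrightarrow> clopenin X (V e)" "disjoint_family_on V E"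
    and cl: "X closure_of (\<Union>(V ` E)) \<subseteq> \<Union>(V ` E) \<union> X closure_of E"
    and S: "\<And>e. e \<in> E \<Longrightarrow> closedin X (S e)" "\<And>e. e \<in> E \<Longrightarrow> S e \<subseteq> V e"
  shows "closedin X (\<Union>(S ` E) \<union> X closure_of E)"
proof -
  let ?T = "\<Union>(S ` E)"
  have sub: "?T \<subseteq> topspace X" using S(1) closedin_subset by fast
  have "X closure_of ?T \<subseteq> ?T \<union> X closure_of E"
  proof
    fix x assume x: "x \<in> X closure_of ?T"
    have "?T \<subseteq> \<Union>(V ` E)" using S(2) by blast
    from closure_of_mono[OF this, of X] have "x \<in> \<Union>(V ` E) \<union> X closure_of E"
      using x cl by blast
    then show "x \<in> ?T \<union> X closure_of E"
    proof
      assume "x \<in> \<Union>(V ` E)"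
      then obtain e where e: "e \<in> E" "x \<in> V e" by blast
      have "x \<in> X closure_of (?T \<inter> V e)"
        using V(1)[OF e(1)] e(2) x by (intro in_closure_of_Int_open) (auto simp: clopenin_def)
      moreover have "?T \<inter> V e \<subseteq> S e"
        using S(2) V(2) e(1) by (fastforce simp: disjoint_family_on_def)
      ultimately have "x \<in> X closure_of (S e)"
        using subsetD[OF closure_of_mono] by simp
      then show ?thesis
        using S(1)[OF e(1)] e(1) by (auto simp: closure_of_closedin)
    qed simp
  qed
  then have "X closure_of (?T \<union> X closure_of E) \<subseteq> ?T \<union> X closure_of E"
    by (simp add: closure_of_Un)
  then show ?thesis
    using sub closure_of_subset_topspace[of X E] closure_of_subset_eq[of "?T \<union> X closure_of E" X] by blast
qed

text \<open>\<open>N\<close> carries a copy of \<open>M\<close> inside \<open>L\<close>, with the same end; \<open>l\<close> and \<open>a\<close> both stand for the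
  common rank of \<open>L\<close> and \<open>M\<close>, as indices over \<open>'b\<close> and over the type of \<open>X\<close>.\<close>

locale germ_pair =
  fixes L :: "'b topology" and N :: "'b set" and e :: 'b and l :: "'b set" and a :: "'a set"
  assumes L: "scattered_compact L" and N: "closedin L N"
    and l: "l \<in> Field (ords TYPE('b))" and a: "a \<in> Field (ords TYPE('a))"
    and iso: "Restr (ords TYPE('a)) (underS (ords TYPE('a)) a) =o Restr (ords TYPE('b)) (underS (ords TYPE('b)) l)"
    and eL: "cb_level L l = {e}" and eN: "cb_level (subtopology L N) l = {e}"
    and diff: "\<not> germ (subtopology L N) e L e"
begin

text \<open>\<open>e\<close> is the sole point of stage \<open>l\<close> both in \<open>L\<close>
  and in its subspace \<open>N\<close>, so the one index \<open>a\<close> serves both types.\<close>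

lemma germ_rank:
  assumes "germ Y x L e \<or> germ Y x (subtopology L N) e"
  shows "x \<in> cb_level (Y :: 'a topology) a" "x \<notin> Y derived_set_of (cb_level Y a)"
proof -
  have H: "Hausdorff_space L" "Hausdorff_space (subtopology L N)"
    using L by (auto simp: scattered_compact_def Hausdorff_space_subtopology)
  note g = germ_cb_iter[OF ords_Well_order ords_Well_order _ a l iso]
  show "x \<in> cb_level Y a"
    using assms g(1)[of Y x L e] g(1)[of Y x "subtopology L N" e] eL eN by blast
  show "x \<notin> Y derived_set_of (cb_level Y a)"
    using assms g(2)[of Y x L e] g(2)[of Y x "subtopology L N" e] derived_set_of_singleton[OF H(1), of e] 
      derived_set_of_singleton[OF H(2), of e] unfolding eL eN by blast
qed

lemma germ_not_both: "germ Y x L e \<Longrightarrow> germ Y x (subtopology L N) e \<Longrightarrow> False"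
  using diff germ_sym germ_trans by metis

text \<open>Quantifying over all sets \<open>J\<close> of colours allows selected colours to be
  altered independently; \<open>{}\<close> and \<open>UNIV\<close> give closedness of
  \<open>A\<close> and of the whole. Since \<open>A\<close> avoids the pieces, it consists of
  accumulation points of \<open>D\<close>. The case \<open>A = {}\<close> is allowed.\<close>

definition system :: "'a topology \<Rightarrow> 'a set \<Rightarrow> ('a \<Rightarrow> nat) \<Rightarrow> ('a \<Rightarrow> 'a set) \<Rightarrow> 'a set \<Rightarrow> bool"
  where "system Y D c P A \<longleftrightarrow>
    (\<forall>d\<in>D. clopenin Y (P d) \<and> P d \<inter> cb_level Y a = {d} \<and> germ Y d L e) \<and>
    disjoint_family_on P D \<and> A \<inter> \<Union>(P ` D) = {} \<and>
    (\<forall>J. closedin Y (A \<union> \<Union>(P ` {d\<in>D. c d \<in> J}))) \<and>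
    (\<forall>n. A \<subseteq> Y closure_of {d\<in>D. c d = n})"

lemma system_piece:
  assumes "system Y D c P A" "d \<in> D"
  shows "clopenin Y (P d)" "P d \<inter> cb_level Y a = {d}" "germ Y d L e" "d \<in> P d" "d \<in> cb_level Y a"
  using assms by (auto simp: system_def)

lemma system_closed:
  assumes "system Y D c P A"
  shows "closedin Y A" "closedin Y (A \<union> \<Union>(P ` D))" "closedin Y (A \<union> \<Union>(P ` {d\<in>D. c d \<in> J}))"
proof -
  show *: "closedin Y (A \<union> \<Union>(P ` {d\<in>D. c d \<in> J}))" for J
    using assms by (simp add: system_def)
  show "closedin Y A" "closedin Y (A \<union> \<Union>(P ` D))"
    using *[of "{}"] *[of UNIV] by simp_all
qed

lemma system_disjoint:
  assumes "system Y D c P A"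
  shows "d \<in> D \<Longrightarrow> d' \<in> D \<Longrightarrow> d \<noteq> d' \<Longrightarrow> P d \<inter> P d' = {}" "d \<in> D \<Longrightarrow> A \<inter> P d = {}" 
  using assms by (auto simp: system_def disjoint_family_on_def)

lemma system_closure:
  assumes "system Y D c P A"
  shows "A \<subseteq> Y closure_of {d\<in>D. c d = n}" "A \<subseteq> Y closure_of D"
proof -
  show *: "A \<subseteq> Y closure_of {d\<in>D. c d = n}" for n
    using assms by (simp add: system_def)
  show "A \<subseteq> Y closure_of D"
    using *[of 0] closure_of_mono[of "{d\<in>D. c d = 0}" D Y] by auto
qed

text \<open>A piece has no point of this rank except its own, and a point of \<open>A\<close>
  outside \<open>D\<close> would be an accumulation point of \<open>D\<close>, which lies in stage
  \<open>a\<close>. Within the system, rank alone thus identifies its points.\<close>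

lemma system_in_points:
  assumes S: "system Y D c P A" and x: "x \<in> A \<union> \<Union>(P ` D)"
    and r: "x \<in> cb_level Y a" "x \<notin> Y derived_set_of (cb_level Y a)"
  shows "x \<in> D"
proof (cases "x \<in> A")
  case True
  then have "x \<in> Y closure_of D"
    using system_closure(2)[OF S] by blast
  moreover have "x \<notin> Y derived_set_of D"
    using r(2) derived_set_of_mono[of D "cb_level Y a" Y] system_piece(5)[OF S] by blast
  ultimately show ?thesis
    by (auto simp: closure_of)
next
  case False
  then obtain d where "d \<in> D" "x \<in> P d" using x by blast
  with system_piece(2)[OF S \<open>d \<in> D\<close>] r(1) have "x = d" by blast
  with \<open>d \<in> D\<close> show ?thesis by simp
qed

section \<open>Transport, restriction and merging of systems\<close>

lemma system_homeomorphic: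
  assumes S: "system Y D c P A" and h: "homeomorphic_map Y Z h" 
    and g: "\<And>x. x \<in> topspace Y \<Longrightarrow> g (h x) = x"
  shows "system Z (h ` D) (\<lambda>d. c (g d)) (\<lambda>d. h ` P (g d)) (h ` A)"
proof -
  have P: "P d \<subseteq> topspace Y" if "d \<in> D" for d
    using system_piece(1)[OF S that] clopenin_subset by blast
  have D: "d \<in> topspace Y" if "d \<in> D" for d
    using system_piece(4)[OF S that] P[OF that] by blast
  have gd: "g (h d) = d" if "d \<in> D" for d
    using g D that by simp
  have A: "A \<subseteq> topspace Y"
    using system_closed(1)[OF S] closedin_subset by blast
  have inj: "inj_on h (topspace Y)"
    using h by (simp add: homeomorphic_imp_injective_map)
  have dis: "h ` U \<inter> h ` V = {}" if "U \<inter> V = {}" "U \<subseteq> topspace Y" "V \<subseteq> topspace Y" for U V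
    using that inj_on_image_Int[OF inj, of U V] by auto
  have col: "{d \<in> h ` D. Q (c (g d))} = h ` {d \<in> D. Q (c d)}" for Q
    using gd by auto
  show ?thesis
    unfolding system_def
  proof (intro conjI ballI allI)
    fix d assume "d \<in> h ` D"
    then obtain x where x: "x \<in> D" "d = h x" by blast
    show "clopenin Z (h ` P (g d))"
      using homeomorphic_map_clopenin[OF h system_piece(1)[OF S x(1)]] gd x by simp
    have "cb_level Z a = h ` cb_level Y a"
      by (rule cb_iter_homeomorphic[OF ords_Well_order ords_Well_order h a a])
        (simp add: ordIso_reflexive Restr_underS_Well_order ords_Well_order)
    moreover have "cb_level Y a \<subseteq> topspace Y"
      by (rule cb_iter_subset[OF ords_Well_order a])
    ultimately show "h ` P (g d) \<inter> cb_level Z a = {d}"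
      using inj_on_image_Int[OF inj P[OF x(1)], of "cb_level Y a"] system_piece(2)[OF S x(1)] gd x by simp
    show "germ Z d L e"
      using germ_trans[OF germ_sym[OF germ_homeomorphic_map[OF h D[OF x(1)]]] system_piece(3)[OF S x(1)]] x(2) by simp
  next
    show "disjoint_family_on (\<lambda>d. h ` P (g d)) (h ` D)"
      unfolding disjoint_family_on_def using dis[OF system_disjoint(1)[OF S]] P gd by auto
  next
    have "h ` A \<inter> h ` P d = {}" if "d \<in> D" for d
      using dis[OF system_disjoint(2)[OF S that] A P[OF that]] .
    then show "h ` A \<inter> (\<Union>d\<in>h ` D. h ` P (g d)) = {}"
      using gd by auto
  next
    fix J
    have "h ` A \<union> (\<Union>d\<in>{d\<in>h ` D. c (g d) \<in> J}. h ` P (g d)) = h ` (A \<union> \<Union>(P ` {d\<in>D. c d \<in> J}))"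
      unfolding col using gd by auto
    then show "closedin Z (h ` A \<union> (\<Union>d\<in>{d\<in>h ` D. c (g d) \<in> J}. h ` P (g d)))"
      using system_closed(3)[OF S, of J] homeomorphic_map_closedness_eq[OF h] by simp
  next
    fix n
    have "Z closure_of (h ` {d \<in> D. c d = n}) = h ` (Y closure_of {d \<in> D. c d = n})"
      by (rule homeomorphic_map_closure_of[OF h]) (use D in auto)
    then show "h ` A \<subseteq> Z closure_of {d \<in> h ` D. c (g d) = n}"
      using system_closure(1)[OF S, of n] col[of "\<lambda>k. k = n"] by auto
  qed
qed

text \<open>Pieces, ranks and germs are local and \<open>C\<close> is open; closedness lifts because
  \<open>C\<close> is closed. Combined with \<open>system_homeomorphic\<close> this brings the CO
  copy of a system back into \<open>X\<close>.\<close>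

lemma system_clopen_lift:
  assumes C: "clopenin Y C" and S: "system (subtopology Y C) D c P A"
  shows "system Y D c P A"
proof -
  have o: "openin Y C" and cl: "closedin Y C" using C by (auto simp: clopenin_def)
  have cb: "cb_level (subtopology Y C) a = C \<inter> cb_level Y a"
    by (rule cb_iter_open[OF ords_Well_order a o])
  show ?thesis
    unfolding system_def
  proof (intro conjI ballI allI)
    fix d assume d: "d \<in> D"
    show P: "clopenin Y (P d)"
      using system_piece(1)[OF S d] by (simp add: clopenin_subtopology[OF C])
    have sub: "P d \<subseteq> C"
      using system_piece(1)[OF S d] by (simp add: clopenin_subtopology[OF C])
    then show "P d \<inter> cb_level Y a = {d}"
      using system_piece(2)[OF S d] unfolding cb by blast
    have "d \<in> C"
      using sub system_piece(4)[OF S d] by blast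
    from germ_trans[OF germ_sym[OF germ_open[OF o this]] system_piece(3)[OF S d]]
    show "germ Y d L e" .
  next
    fix J show "closedin Y (A \<union> \<Union>(P ` {d\<in>D. c d \<in> J}))"
      using system_closed(3)[OF S] cl closedin_trans_full by blast
  next
    fix n show "A \<subseteq> Y closure_of {d \<in> D. c d = n}"
      using system_closure(1)[OF S, of n] closure_of_subtopology_subset[of Y C] 
      by (meson Int_lower2 closure_of_mono order_trans closure_of_subtopology)
  qed (use S in \<open>auto simp: system_def\<close>)
qed

lemma system_restrict:
  assumes W: "clopenin Y W" and S: "system Y D c P A"
  shows "system Y (D \<inter> W) c (\<lambda>d. P d \<inter> W) (A \<inter> W)"
proof -
  have o: "openin Y W" and cl: "closedin Y W" using W by (auto simp: clopenin_def)
  show ?thesis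
    unfolding system_def
  proof (intro conjI ballI allI)
    fix d assume "d \<in> D \<inter> W"
    then have d: "d \<in> D" "d \<in> W" by simp_all
    show "clopenin Y (P d \<inter> W)"
      by (rule clopenin_Int[OF system_piece(1)[OF S d(1)] W])
    show "P d \<inter> W \<inter> cb_level Y a = {d}"
      using system_piece(2)[OF S d(1)] d(2) by blast
    show "germ Y d L e"
      by (rule system_piece(3)[OF S d(1)])
  next
    fix J
    \<comment> \<open>A piece may meet \<open>W\<close> although its point lies outside; such pieces
      are removed, which takes away only an open set.\<close>
    have "A \<inter> W \<union> (\<Union>d\<in>{d \<in> D \<inter> W. c d \<in> J}. P d \<inter> W)
      = (A \<union> \<Union>(P ` {d\<in>D. c d \<in> J})) \<inter> (W - \<Union>(P ` (D - W)))"
      using system_disjoint[OF S] by blast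
    moreover have "closedin Y (W - \<Union>(P ` (D - W)))"
      by (intro closedin_diff cl openin_Union) (use system_piece(1)[OF S] in \<open>auto simp: clopenin_def\<close>)
    ultimately show "closedin Y (A \<inter> W \<union> (\<Union>d\<in>{d \<in> D \<inter> W. c d \<in> J}. P d \<inter> W))"
      using system_closed(3)[OF S, of J] by (simp add: closedin_Int)
  next
    fix n
    have "{d\<in>D. c d = n} \<inter> W = {d \<in> D \<inter> W. c d = n}" by auto
    then show "A \<inter> W \<subseteq> Y closure_of {d \<in> D \<inter> W. c d = n}"
      using in_closure_of_Int_open[OF o, of _ "{d\<in>D. c d = n}"] system_closure(1)[OF S, of n] by auto
  qed (use system_disjoint[OF S] in \<open>auto simp: disjoint_family_on_def\<close>)
qed

text \<open>\<open>\<phi>\<close> selects the colours to keep and \<open>inv \<phi>\<close>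
  renumbers them by all of \<open>nat\<close>; each new colour class is an old one, so its closure
  still contains \<open>A\<close>. \<open>F\<close> may contain more than the kept pieces, and this
  leaves room for thinned ones.\<close>

lemma system_subtopology:
  assumes S: "system Y D c P A" and \<phi>: "inj \<phi>" and D': "D' = {d\<in>D. c d \<in> range \<phi>}"
    and F: "A \<union> \<Union>(P ` D') \<subseteq> F"
  shows "system (subtopology Y F) D' (\<lambda>d. inv \<phi> (c d)) P A"
proof -
  have col: "{d\<in>D'. inv \<phi> (c d) \<in> J} = {d\<in>D. c d \<in> \<phi> ` J}" for J
    using \<phi> unfolding D' by (auto simp: inv_f_f)
  show ?thesis
    unfolding system_def
  proof (intro conjI ballI allI)
    fix d assume d: "d \<in> D'"
    then have dD: "d \<in> D" and sub: "P d \<subseteq> F" using F by (auto simp: D')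
    show c: "clopenin (subtopology Y F) (P d)"
      using clopenin_subtopology_Int[OF system_piece(1)[OF S dD], of F] sub by (simp add: inf_absorb1)
    then have o: "openin (subtopology Y F) (P d)" by (simp add: clopenin_def)
    have oY: "openin Y (P d)" using system_piece(1)[OF S dD] by (simp add: clopenin_def)
    have eq: "subtopology (subtopology Y F) (P d) = subtopology Y (P d)"
      using sub by (simp add: subtopology_subtopology inf_absorb2)
    have "P d \<inter> cb_level (subtopology Y F) a = P d \<inter> cb_level Y a"
      using cb_iter_open[OF ords_Well_order a o] cb_iter_open[OF ords_Well_order a oY] unfolding eq by simp
    then show "P d \<inter> cb_level (subtopology Y F) a = {d}"
      using system_piece(2)[OF S dD] by simp
    have "germ (subtopology Y (P d)) d (subtopology Y F) d" "germ (subtopology Y (P d)) d Y d"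
      using germ_open_subtopology[OF o] germ_open[OF oY] system_piece(4)[OF S dD] by auto
    then show "germ (subtopology Y F) d L e"
      using germ_trans[OF germ_sym germ_trans] system_piece(3)[OF S dD] by metis
  next
    fix J
    have "A \<union> \<Union>(P ` {d \<in> D'. inv \<phi> (c d) \<in> J}) \<subseteq> F" using F by blast
    then show "closedin (subtopology Y F) (A \<union> \<Union>(P ` {d \<in> D'. inv \<phi> (c d) \<in> J}))"
      using system_closed(3)[OF S, of "\<phi> ` J"] unfolding col by (intro closedin_subset_topspace)
  next
    fix n
    have *: "{d\<in>D'. inv \<phi> (c d) = n} = {d\<in>D. c d = \<phi> n}"
      using col[of "{n}"] by auto
    have "d \<in> F" if "d \<in> D'" for d
      using that F system_piece(4)[OF S, of d] unfolding D' by blast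
    then have "F \<inter> {d\<in>D'. inv \<phi> (c d) = n} = {d\<in>D. c d = \<phi> n}"
      using * by blast
    then show "A \<subseteq> subtopology Y F closure_of {d \<in> D'. inv \<phi> (c d) = n}"
      using system_closure(1)[OF S, of "\<phi> n"] F by (auto simp: closure_of_subtopology)
  qed (use system_disjoint[OF S] in \<open>auto simp: disjoint_family_on_def D'\<close>)
qed

text \<open>Each system is cut down to its own \<open>V b\<close>, so pieces of different systems
  are disjoint and the colours can be kept. Closedness forces the closure of \<open>E\<close> into
  the new limit set; the closure of every colour class contains it, since it contains each
  \<open>b\<close>.\<close>

lemma system_merge:
  assumes V: "\<And>b. b \<in> E \<Longrightarrow> clopenin Y (V b)" "\<And>b. b \<in> E \<Longrightarrow> b \<in> V b" "disjoint_family_on V E"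
    and cl: "Y closure_of (\<Union>(V ` E)) \<subseteq> \<Union>(V ` E) \<union> Y closure_of E"
    and S: "\<And>b. b \<in> E \<Longrightarrow> \<exists>D c P A. system Y D c P A \<and> b \<in> cb_level (subtopology Y A) (\<gamma> b)"
    and \<gamma>: "\<And>b. b \<in> E \<Longrightarrow> \<gamma> b \<in> Field (ords TYPE('a))"
  obtains D c P A where "system Y D c P A" "\<And>b. b \<in> E \<Longrightarrow> b \<in> cb_level (subtopology Y A) (\<gamma> b)" "E \<subseteq> A"
proof -
  have "\<exists>D c P A. system Y D c P A \<and> b \<in> cb_level (subtopology Y A) (\<gamma> b) \<and> D \<subseteq> V b \<and> (\<forall>d. P d \<subseteq> V b) \<and> A \<subseteq> V b"
    if b: "b \<in> E" for b
  proof -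
    obtain D c P A where S: "system Y D c P A" "b \<in> cb_level (subtopology Y A) (\<gamma> b)"
      using S[OF b] by blast
    have o: "openin (subtopology Y A) (A \<inter> V b)"
      using V(1)[OF b] by (auto simp: clopenin_def openin_subtopology_Int2)
    have "subtopology (subtopology Y A) (A \<inter> V b) = subtopology Y (A \<inter> V b)"
      by (simp add: subtopology_subtopology Int_assoc[symmetric])
    then have "cb_level (subtopology Y (A \<inter> V b)) (\<gamma> b) = A \<inter> V b \<inter> cb_level (subtopology Y A) (\<gamma> b)"
      using cb_iter_open[OF ords_Well_order \<gamma>[OF b] o] by simp
    moreover have "b \<in> A"
      using S(2) cb_iter_subset[OF ords_Well_order \<gamma>[OF b], of "subtopology Y A"] by auto
    ultimately show ?thesis
      using system_restrict[OF V(1)[OF b] S(1)] S(2) V(2)[OF b]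
      by (intro exI[of _ "D \<inter> V b"] exI[of _ c] exI[of _ "\<lambda>d. P d \<inter> V b"] exI[of _ "A \<inter> V b"]) auto
  qed
  then obtain D c P A where S: "\<And>b. b \<in> E \<Longrightarrow> system Y (D b) (c b) (P b) (A b)"
    and Sb: "\<And>b. b \<in> E \<Longrightarrow> b \<in> cb_level (subtopology Y (A b)) (\<gamma> b)"
    and sub: "\<And>b. b \<in> E \<Longrightarrow> D b \<subseteq> V b" "\<And>b d. b \<in> E \<Longrightarrow> P b d \<subseteq> V b" "\<And>b. b \<in> E \<Longrightarrow> A b \<subseteq> V b"
    by metis
  have bA: "b \<in> A b" if "b \<in> E" for b
    using Sb[OF that] cb_iter_subset[OF ords_Well_order \<gamma>[OF that], of "subtopology Y (A b)"] by auto
  have dis: "b = b'" if "b \<in> E" "b' \<in> E" "x \<in> V b" "x \<in> V b'" for x b b'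
    using V(3) that by (auto simp: disjoint_family_on_def)
  define own where "own x = (THE b. b \<in> E \<and> x \<in> V b)" for x
  have own: "own x = b" if "b \<in> E" "x \<in> V b" for x b
    unfolding own_def using that dis by (intro the_equality) auto
  have ownD: "own d = b" if "b \<in> E" "d \<in> D b" for b d
    using own that sub(1) by blast
  let ?D = "\<Union>(D ` E)" and ?c = "\<lambda>d. c (own d) d" and ?P = "\<lambda>d. P (own d) d" 
  let ?A = "\<Union>(A ` E) \<union> Y closure_of E"
  have E: "E \<subseteq> topspace Y"
    using V(1,2) clopenin_subset by blast
  \<comment> \<open>Within \<open>V b\<close> the only point of \<open>E\<close> is
    \<open>b\<close>, which already lies in \<open>A b\<close>, so adding the closure of
    \<open>E\<close> does not touch the pieces.\<close>
  have clE: "Y closure_of E \<inter> V b \<subseteq> A b" if b: "b \<in> E" for b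
  proof
    fix x assume x: "x \<in> Y closure_of E \<inter> V b"
    then have "x \<in> Y closure_of (E \<inter> V b)"
      using V(1)[OF b] by (intro in_closure_of_Int_open) (auto simp: clopenin_def)
    moreover have "E \<inter> V b \<subseteq> A b"
      using bA b V(2) dis by blast
    ultimately have "x \<in> Y closure_of (A b)"
      using closure_of_mono by blast
    then show "x \<in> A b"
      using system_closed(1)[OF S[OF b]] by (simp add: closure_of_closedin)
  qed
  have "system Y ?D ?c ?P ?A"
    unfolding system_def
  proof (intro conjI ballI allI)
    fix d assume "d \<in> ?D"
    then obtain b where b: "b \<in> E" "d \<in> D b" by blast
    show "clopenin Y (?P d)" "?P d \<inter> cb_level Y a = {d}" "germ Y d L e"
      using system_piece[OF S[OF b(1)] b(2)] ownD[OF b] by simp_all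
  next
    show "disjoint_family_on ?P ?D"
      unfolding disjoint_family_on_def
    proof (intro ballI impI)
      fix d d' assume "d \<in> ?D" "d' \<in> ?D" and ne: "d \<noteq> d'"
      then obtain b b' where b: "b \<in> E" "d \<in> D b" "b' \<in> E" "d' \<in> D b'" by blast
      show "?P d \<inter> ?P d' = {}"
      proof (cases "b = b'")
        case True
        then show ?thesis
          using system_disjoint(1)[OF S[OF b(1)] b(2), of d'] b ne ownD by simp
      next
        case False
        then show ?thesis
          using sub(2)[OF b(1), of d] sub(2)[OF b(3), of d'] dis[OF b(1,3)] ownD b by auto
      qed
    qed
  next
    have "?A \<inter> P b d = {}" if b: "b \<in> E" "d \<in> D b" for b d
    proof -
      have "A b' \<inter> P b d = {}" if "b' \<in> E" for b'
        using system_disjoint(2)[OF S[OF b(1)] b(2)] sub(3)[OF that] sub(2)[OF b(1), of d] dis[OF b(1) that]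
        by blast
      moreover have "Y closure_of E \<inter> P b d = {}"
        using system_disjoint(2)[OF S[OF b(1)] b(2)] sub(2)[OF b(1), of d] clE[OF b(1)] by blast
      ultimately show ?thesis by blast
    qed
    then show "?A \<inter> \<Union>(?P ` ?D) = {}"
      using ownD by auto
  next
    fix J
    have "?A \<union> \<Union>(?P ` {d \<in> ?D. ?c d \<in> J}) = (\<Union>b\<in>E. A b \<union> \<Union>(P b ` {d \<in> D b. c b d \<in> J})) \<union> Y closure_of E"
      using ownD by auto
    moreover have "closedin Y \<dots>"
    proof (rule closedin_merge[OF V(1,3) cl])
      show "A b \<union> \<Union>(P b ` {d \<in> D b. c b d \<in> J}) \<subseteq> V b" if "b \<in> E" for b
        using sub(2,3)[OF that] by blast
    qed (use system_closed(3)[OF S] in auto)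
    ultimately show "closedin Y (?A \<union> \<Union>(?P ` {d \<in> ?D. ?c d \<in> J}))"
      by simp
  next
    fix n
    let ?Dn = "{d \<in> ?D. ?c d = n}"
    have *: "A b \<subseteq> Y closure_of ?Dn" if "b \<in> E" for b
    proof -
      have "{d \<in> D b. c b d = n} \<subseteq> ?Dn" using that ownD by auto
      from closure_of_mono[OF this] system_closure(1)[OF S[OF that]] show ?thesis by blast
    qed
    then have "E \<subseteq> Y closure_of ?Dn" using bA by blast
    then have "Y closure_of E \<subseteq> Y closure_of ?Dn" by (simp add: closure_of_minimal)
    with * show "?A \<subseteq> Y closure_of ?Dn" by blast
  qed
  moreover have "b \<in> cb_level (subtopology Y ?A) (\<gamma> b)" if "b \<in> E" for b
    using Sb[OF that] cb_iter_mono[OF ords_Well_order \<gamma>[OF that], of "A b" ?A Y] that by auto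
  moreover have "E \<subseteq> ?A"
    using closure_of_subset[OF E] by blast
  ultimately show ?thesis
    by (intro that)
qed

text \<open>A neighbourhood of \<open>d\<close> is a copy of a neighbourhood of \<open>e\<close> in
  \<open>L\<close>; pulling \<open>N\<close> back to it leaves a closed part of the piece that looks
  like \<open>N\<close> at \<open>d\<close>.\<close>

lemma system_thin_piece:
  assumes Y: "scattered_compact Y" and S: "system Y D c P A" "d \<in> D"
  obtains T where "T \<subseteq> P d" "closedin Y T" "d \<in> T" "germ (subtopology Y T) d (subtopology L N) e"
proof -
  have P: "openin Y (P d)" using system_piece(1)[OF S] by (simp add: clopenin_def)
  obtain U V f where f: "clopenin Y U" "d \<in> U" "U \<subseteq> P d" "clopenin L V" "e \<in> V"
    "homeomorphic_map (subtopology Y U) (subtopology L V) f" "f d = e"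
    by (rule germ_clopenE[OF system_piece(3)[OF S] Y L P system_piece(4)[OF S]])
  define T where "T = {u \<in> U. f u \<in> N}"
  note UV = clopenin_subset[OF f(1)] clopenin_subset[OF f(4)]
  have fU: "f ` U = V"
    using homeomorphic_imp_surjective_map[OF f(6)] UV by (simp add: inf_absorb2)
  have "closedin (subtopology L V) (V \<inter> N)"
    using N by (rule closedin_subtopology_Int_closed)
  then have "closedin (subtopology Y U) {u \<in> topspace (subtopology Y U). f u \<in> V \<inter> N}"
    using closedin_continuous_map_preimage[OF homeomorphic_imp_continuous_map[OF f(6)]] by blast
  moreover have "{u \<in> topspace (subtopology Y U). f u \<in> V \<inter> N} = T"
    using UV fU by (auto simp: T_def)
  ultimately have "closedin (subtopology Y U) T" by simp
  then have clT: "closedin Y T"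
    using f(1) closedin_trans_full by (auto simp: clopenin_def)
  have TU: "T \<subseteq> U" by (auto simp: T_def)
  have fT: "f ` T = V \<inter> N" using fU by (auto simp: T_def)
  have "homeomorphic_map (subtopology Y T) (subtopology L (V \<inter> N)) f"
    using homeomorphic_map_subtopology_image(1)[OF f(6) UV TU] fT by simp
  moreover have "e \<in> N"
    using eN cb_iter_subset[OF ords_Well_order l, of "subtopology L N"] by auto
  then have dT: "d \<in> T" using f by (simp add: T_def)
  ultimately have "germ (subtopology Y T) d (subtopology L (V \<inter> N)) e"
    using germ_homeomorphic_map[of "subtopology Y T" _ f d] f(7) TU UV by auto
  moreover have "openin (subtopology L N) (V \<inter> N)"
    using f(4) by (auto simp: clopenin_def openin_subtopology)
  then have "germ (subtopology L (V \<inter> N)) e (subtopology L N) e"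
    using \<open>e \<in> N\<close> f(5) by (intro germ_open_subtopology) auto
  ultimately have "germ (subtopology Y T) d (subtopology L N) e"
    by (rule germ_trans)
  with clT dT TU f(3) show ?thesis
    by (intro that[of T]) auto
qed

end

section \<open>Limit points of systems in a CO space\<close>

lemma CO_space_copy:
  assumes "CO_space X" "closedin X F"
  obtains C h where "clopenin X C" "homeomorphic_map (subtopology X F) (subtopology X C) h" "h ` F = C"
proof -
  obtain C h where C: "clopenin X C" "homeomorphic_map (subtopology X F) (subtopology X C) h"
    using assms unfolding CO_space_def homeomorphic_space by blast
  moreover have "h ` F = C"
    using homeomorphic_imp_surjective_map[OF C(2)] clopenin_subset[OF C(1)] closedin_subset[OF assms(2)]
    by (simp add: inf_absorb2)
  ultimately show ?thesis using that by blast
qed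

lemma scattered_compact_isolated_point:
  assumes "scattered_compact X" "T \<subseteq> topspace X" "T \<noteq> {}"
  obtains b W where "clopenin X W" "W \<inter> T = {b}"
proof -
  obtain b where b: "b \<in> T" "openin (subtopology X T) {b}"
    using assms unfolding scattered_compact_def by blast
  then obtain U where U: "openin X U" "{b} = U \<inter> T"
    by (auto simp: openin_subtopology)
  obtain W where "clopenin X W" "b \<in> W" "W \<subseteq> U"
    using scattered_compact_clopen_base[OF assms(1) U(1), of b] U(2) by blast
  with U(2) b(1) show ?thesis
    by (intro that[of W b]) auto
qed

lemma clopen_strong_Hausdorff_systemD:
  assumes "clopen_strong_Hausdorff_system X D V"
  shows "D \<subseteq> topspace X" "\<And>d. d \<in> D \<Longrightarrow> clopenin X (V d)" "\<And>d. d \<in> D \<Longrightarrow> d \<in> V d"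
    "disjoint_family_on V D" "X closure_of (\<Union>(V ` D)) \<subseteq> \<Union>(V ` D) \<union> X closure_of D"
  using assms
  by (auto simp: clopen_strong_Hausdorff_system_def strong_Hausdorff_system_def disjoint_family_on_def
      clopenin_def closure_of_closedin)

lemma infinite_derived_set:
  assumes "scattered_compact X" "S \<subseteq> topspace X" "infinite S"
  shows "X derived_set_of S \<noteq> {}"
proof
  assume "X derived_set_of S = {}"
  then have "closedin X S"
    using assms(2) closedin_contains_derived_set[of X S] by simp
  then have "compactin X S"
    using assms(1) closedin_compact_space by (auto simp: scattered_compact_def)
  then show False
    using Hausdorff_space_discrete_compactin[of X S] assms \<open>X derived_set_of S = {}\<close>
    by (auto simp: scattered_compact_def)
qed

locale CO_germ_pair = germ_pair L N e l a
  for L :: "'b topology" and N :: "'b set" and e :: 'b and l :: "'b set" and a :: "'a set" +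
  fixes X :: "'a topology"
  assumes X: "scattered_compact X" and CO: "CO_space X"
    and SH: "\<And>S. S \<subseteq> topspace X \<Longrightarrow> infinite S \<Longrightarrow> regularCard |S| \<Longrightarrow>
      \<exists>D V. D \<subseteq> S \<and> |D| =o |S| \<and> clopen_strong_Hausdorff_system X D V"
begin

text \<open>Written \<open>B\<^sub>i\<close> in the overview. The stage is that of \<open>A\<close>
  as a space of its own, not of \<open>X\<close>, and \<open>A\<close> varies with the
  system.\<close>

definition limit_points :: "'a set \<Rightarrow> 'a set"
  where "limit_points i = {b. \<exists>D c P A. system X D c P A \<and> b \<in> cb_level (subtopology X A) i}"

lemma limit_pointsI: "system X D c P A \<Longrightarrow> b \<in> cb_level (subtopology X A) i \<Longrightarrow> b \<in> limit_points i"
  unfolding limit_points_def by blast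

lemma Hausdorff: "Hausdorff_space X"
  using X by (simp add: scattered_compact_def)

lemma cb_level_subset: "i \<in> Field (ords TYPE('a)) \<Longrightarrow> cb_level (subtopology X A) i \<subseteq> topspace X \<inter> A"
  using cb_iter_subset[OF ords_Well_order, of i "subtopology X A"] by simp

lemma limit_points_subset: "i \<in> Field (ords TYPE('a)) \<Longrightarrow> limit_points i \<subseteq> topspace X"
  using cb_level_subset by (fastforce simp: limit_points_def)

lemma system_copy:
  assumes S: "system (subtopology X F) D c P A" and F: "closedin X F" and A: "A \<union> \<Union>(P ` D) = F'" "F' \<subseteq> F"
    and h: "clopenin X C" "homeomorphic_map (subtopology X F) (subtopology X C) h"
  obtains c' P' where "system X (h ` D) c' P' (h ` A)"
    "\<And>i. i \<in> Field (ords TYPE('a)) \<Longrightarrow> cb_level (subtopology X (h ` A)) i = h ` cb_level (subtopology X A) i"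
    "h ` A \<union> \<Union>(P' ` (h ` D)) = h ` F'"
proof -
  obtain g where g: "\<And>x. x \<in> topspace (subtopology X F) \<Longrightarrow> g (h x) = x"
    by (rule homeomorphic_map_inverse[OF h(2)]) (rule that)
  have tF: "topspace (subtopology X F) = F"
    using closedin_subset[OF F] by (simp add: inf_absorb2)
  have S': "system X (h ` D) (\<lambda>d. c (g d)) (\<lambda>d. h ` P (g d)) (h ` A)"
    by (rule system_clopen_lift[OF h(1) system_homeomorphic[OF S h(2) g]])
  have "g (h d) = d" if "d \<in> D" for d
    using g[unfolded tF, of d] system_piece(4)[OF S that] that A by auto
  then have "h ` A \<union> (\<Union>d\<in>h ` D. h ` P (g d)) = h ` F'"
    using A(1) by auto
  moreover have "cb_level (subtopology X (h ` A)) i = h ` cb_level (subtopology X A) i"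
    if "i \<in> Field (ords TYPE('a))" for i
  proof (rule cb_iter_homeomorphic[OF ords_Well_order ords_Well_order _ that that])
    show "homeomorphic_map (subtopology X A) (subtopology X (h ` A)) h"
      using A by (intro homeomorphic_map_subtopology_image(1)[OF h(2) closedin_subset[OF F] clopenin_subset[OF h(1)]]) auto
  qed (simp add: ordIso_reflexive Restr_underS_Well_order ords_Well_order)
  ultimately show ?thesis
    using that[OF S'] by blast
qed

text \<open>Suppose a point \<open>x\<close> of \<open>A2\<close> falls into a piece
  \<open>P d\<close>. By rank, \<open>d\<close> is the only point of \<open>D2\<close> that
  \<open>P d\<close> can contain; as \<open>x\<close> is in the closure of \<open>D2\<close>, it
  follows that \<open>x = d\<close> and \<open>d \<in> D2\<close>, but \<open>A2\<close> avoids the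
  points of its own system.\<close>

lemma system_open_copy_maximal:
  assumes S: "system X D c P A" and o: "openin X (A \<union> \<Union>(P ` D))" and S2: "system X D2 c2 P2 A2"
  shows "A2 \<inter> (A \<union> \<Union>(P ` D)) \<subseteq> A"
proof
  let ?C = "A \<union> \<Union>(P ` D)"
  fix x assume x: "x \<in> A2 \<inter> ?C"
  show "x \<in> A"
  proof (rule ccontr)
    assume "x \<notin> A"
    then obtain d where d: "d \<in> D" "x \<in> P d" using x by blast
    have oP: "openin X (P d)"
      using system_piece(1)[OF S d(1)] by (simp add: clopenin_def)
    have x2: "x \<in> X closure_of D2"
      using system_closure(2)[OF S2] x by blast
    have D2: "D2 \<inter> P d \<subseteq> {d}"
      using system_piece(2)[OF S d(1)] system_piece(5)[OF S2] by blast
    have "x \<in> X closure_of (D2 \<inter> P d)"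
      by (rule in_closure_of_Int_open[OF oP d(2) x2])
    moreover have "closedin X {d}"
      using Hausdorff system_piece(1,4)[OF S d(1)] clopenin_subset by (fastforce intro: closedin_Hausdorff_finite)
    ultimately have "x = d" "d \<in> D2"
      using closure_of_minimal[of "D2 \<inter> P d" "{d}" X] D2 by (cases "D2 \<inter> P d = {}"; auto)+
    with x system_piece(4)[OF S2, of d] system_disjoint(2)[OF S2, of d] show False
      by blast
  qed
qed

lemma system_total:
  assumes S: "system X D c P A"
  obtains c' where "system (subtopology X (A \<union> \<Union>(P ` D))) D c' P A"
  using system_subtopology[OF S, of id D "A \<union> \<Union>(P ` D)"] by auto

text \<open>Around an isolated point of stage \<open>i\<close> of some \<open>A\<close> the system
  is cut down until that stage is a single point, and then copied onto a clopen set. Any other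
  system has its limit set there inside the copied one, so it cannot pass stage \<open>i\<close> at
  that point.\<close>

lemma limit_points_exact:
  assumes i: "i \<in> Field (ords TYPE('a))" and ne: "limit_points i \<noteq> {}"
  obtains b where "b \<in> limit_points i" 
    "\<And>j. j \<in> Field (ords TYPE('a)) \<Longrightarrow> i \<in> underS (ords TYPE('a)) j \<Longrightarrow> b \<notin> limit_points j"
proof -
  obtain D c P A where S: "system X D c P A" and T: "cb_level (subtopology X A) i \<noteq> {}"
    using ne unfolding limit_points_def by blast
  obtain b W where W: "clopenin X W" "W \<inter> cb_level (subtopology X A) i = {b}"
    by (rule scattered_compact_isolated_point[OF X _ T])
      (use cb_level_subset[OF i, of A] in \<open>auto intro: that\<close>)
  let ?A = "A \<inter> W" and ?D = "D \<inter> W" and ?P = "\<lambda>d. P d \<inter> W"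
  let ?F = "?A \<union> \<Union>(?P ` ?D)"
  note S' = system_restrict[OF W(1) S]
  have "openin (subtopology X A) ?A"
    using W(1) by (auto simp: clopenin_def openin_subtopology_Int2)
  from cb_iter_open[OF ords_Well_order i this]
  have b: "cb_level (subtopology X ?A) i = {b}"
    using W(2) cb_level_subset[OF i, of A] by (auto simp: subtopology_subtopology Int_assoc[symmetric])
  obtain c' where S'': "system (subtopology X ?F) ?D c' ?P ?A"
    by (rule system_total[OF S'])
  have F: "closedin X ?F" by (rule system_closed(2)[OF S'])
  obtain C h where h: "clopenin X C" "homeomorphic_map (subtopology X ?F) (subtopology X C) h" "h ` ?F = C"
    by (rule CO_space_copy[OF CO F])
  obtain c2 P2 where S2: "system X (h ` ?D) c2 P2 (h ` ?A)"
    and cb: "\<And>i. i \<in> Field (ords TYPE('a)) \<Longrightarrow> cb_level (subtopology X (h ` ?A)) i = h ` cb_level (subtopology X ?A) i"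
    and F2: "h ` ?A \<union> \<Union>(P2 ` (h ` ?D)) = h ` ?F"
    by (rule system_copy[OF S'' F refl subset_refl h(1,2)]) (rule that)
  have hb: "cb_level (subtopology X (h ` ?A)) i = {h b}"
    using cb[OF i] b by simp
  have hbC: "h b \<in> C"
    using cb_level_subset[OF i, of ?A] b h(3) by blast
  show ?thesis
  proof (rule that[of "h b"])
    show "h b \<in> limit_points i"
      by (rule limit_pointsI[OF S2]) (simp add: hb)
  next
    fix j assume j: "j \<in> Field (ords TYPE('a))" "i \<in> underS (ords TYPE('a)) j"
    show "h b \<notin> limit_points j"
    proof
      assume "h b \<in> limit_points j"
      then obtain D3 c3 P3 A3 where S3: "system X D3 c3 P3 A3" "h b \<in> cb_level (subtopology X A3) j"
        by (auto simp: limit_points_def)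
      have sub: "A3 \<inter> C \<subseteq> h ` ?A"
        using system_open_copy_maximal[OF S2 _ S3(1)] F2 h(1,3) by (simp add: clopenin_def)
      have "openin (subtopology X A3) (A3 \<inter> C)"
        using h(1) by (auto simp: clopenin_def openin_subtopology_Int2)
      from cb_iter_open[OF ords_Well_order j(1) this]
      have "h b \<in> cb_level (subtopology X (A3 \<inter> C)) j"
        using S3(2) hbC cb_level_subset[OF j(1), of A3] by (auto simp: subtopology_subtopology Int_assoc[symmetric])
      then have "h b \<in> cb_level (subtopology X (h ` ?A)) j"
        using cb_iter_mono[OF ords_Well_order j(1) sub, of X] by blast
      then have "h b \<in> subtopology X (h ` ?A) derived_set_of {h b}"
        using cb_iter_derived[OF ords_Well_order j] hb by metis
      then show False
        using derived_set_of_singleton[OF Hausdorff_space_subtopology[OF Hausdorff]] by blast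
    qed
  qed
qed

text \<open>If there were only finitely many limit points, a system accumulating at all of them could be
  copied onto a clopen set both as it stands and with half of its pieces thinned to type \<open>N\<close>; both
  copies would have to contain all limit points, but only the second one has points of type \<open>N\<close>
  near them.\<close>

lemma limit_points_infinite:
  assumes i: "i \<in> Field (ords TYPE('a))" and ne: "limit_points i \<noteq> {}"
  shows "infinite (limit_points i)"
proof
  let ?B = "limit_points i"
  assume fin: "finite ?B"
  have B: "?B \<subseteq> topspace X" by (rule limit_points_subset[OF i])
  obtain W where W: "\<And>b. b \<in> ?B \<Longrightarrow> clopenin X (W b)" "\<And>b. b \<in> ?B \<Longrightarrow> b \<in> W b" "disjoint_family_on W ?B"
    by (rule finite_disjoint_clopen[OF X fin B]) (rule that)
  \<comment> \<open>For finitely many clopen sets the strong Hausdorff condition is automatic, so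
    one system reaches all of \<open>?B\<close>.\<close>
  have "closedin X (\<Union>(W ` ?B))"
    using fin W(1) by (auto simp: clopenin_def intro!: closedin_Union)
  then have cl: "X closure_of (\<Union>(W ` ?B)) \<subseteq> \<Union>(W ` ?B) \<union> X closure_of ?B"
    by (simp add: closure_of_closedin)
  obtain D c P A where S: "system X D c P A" and BA: "\<And>b. b \<in> ?B \<Longrightarrow> b \<in> cb_level (subtopology X A) i"
    by (rule system_merge[OF W cl, of "\<lambda>_. i"]) (auto simp: limit_points_def i)
  have eqB: "cb_level (subtopology X A) i = ?B"
    using BA S unfolding limit_points_def by blast
  \<comment> \<open>An injection of a finite set into itself is onto: a copy of \<open>A\<close>
    that carries a system in \<open>X\<close> passes through every point of
    \<open>?B\<close>.\<close>
  have inB: "h ` ?B = ?B" if "system X D' c' P' (h ` A)" "inj_on h A"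
    "cb_level (subtopology X (h ` A)) i = h ` cb_level (subtopology X A) i" for h D' c' P'
  proof -
    have "h ` ?B \<subseteq> ?B"
      using limit_pointsI[OF that(1), of _ i] unfolding that(3) eqB by blast
    moreover have "inj_on h ?B"
      using that(2) cb_level_subset[OF i, of A] unfolding eqB by (auto intro: inj_on_subset)
    ultimately show ?thesis
      using fin by (simp add: endo_inj_surj)
  qed
  have tsub: "A \<union> \<Union>(P ` D) \<subseteq> topspace X"
    using system_closed(2)[OF S] closedin_subset by blast

  let ?F1 = "A \<union> \<Union>(P ` D)"
  have F1: "closedin X ?F1" by (rule system_closed(2)[OF S])
  obtain c1 where S1: "system (subtopology X ?F1) D c1 P A"
    by (rule system_total[OF S])
  obtain C1 h1 where h1: "clopenin X C1" "homeomorphic_map (subtopology X ?F1) (subtopology X C1) h1" "h1 ` ?F1 = C1"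
    by (rule CO_space_copy[OF CO F1])
  obtain c1' P1 where S1': "system X (h1 ` D) c1' P1 (h1 ` A)"
    and cb1: "\<And>i. i \<in> Field (ords TYPE('a)) \<Longrightarrow> cb_level (subtopology X (h1 ` A)) i = h1 ` cb_level (subtopology X A) i"
    and F1': "h1 ` A \<union> \<Union>(P1 ` (h1 ` D)) = h1 ` ?F1"
    by (rule system_copy[OF S1 F1 refl subset_refl h1(1,2)]) (rule that)
  have inj1: "inj_on h1 ?F1"
    using homeomorphic_imp_injective_map[OF h1(2)] tsub by (simp add: inf_absorb2)
  have "h1 ` ?B = ?B"
    by (rule inB[OF S1' _ cb1[OF i]]) (rule inj_on_subset[OF inj1], simp)
  moreover have "?B \<subseteq> A"
    using eqB cb_level_subset[OF i] by blast
  ultimately have BC: "?B \<subseteq> C1"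
    using h1(3) by blast
  \<comment> \<open>A point of type \<open>N\<close> has the rank of the system points and is
    isolated at that level, so inside \<open>C1\<close> it would be one of them; these have type
    \<open>L\<close>.\<close>
  have noN: "\<not> germ X x (subtopology L N) e" if "x \<in> C1" for x
  proof
    assume g: "germ X x (subtopology L N) e"
    have "x \<in> h1 ` D"
      using that h1(3) F1' germ_rank[of X x] g by (intro system_in_points[OF S1']) auto
    then show False
      using germ_not_both[OF system_piece(3)[OF S1'] g] by blast
  qed

  have "\<forall>d\<in>D. \<exists>T. T \<subseteq> P d \<and> closedin X T \<and> d \<in> T \<and> germ (subtopology X T) d (subtopology L N) e"
    using system_thin_piece[OF X S] by metis
  from bchoice[OF this] obtain T where T: "\<And>d. d \<in> D \<Longrightarrow> T d \<subseteq> P d" "\<And>d. d \<in> D \<Longrightarrow> closedin X (T d)" 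
    "\<And>d. d \<in> D \<Longrightarrow> d \<in> T d" "\<And>d. d \<in> D \<Longrightarrow> germ (subtopology X (T d)) d (subtopology L N) e"
    by blast
  \<comment> \<open>Even colours keep their pieces and still form a system; the pieces of odd
    colours are thinned to type \<open>N\<close>.\<close>
  let ?\<phi> = "\<lambda>n::nat. 2 * n"
  define De where "De = {d\<in>D. c d \<in> range ?\<phi>}"
  let ?F2 = "A \<union> \<Union>(P ` De) \<union> \<Union>(T ` (D - De))"
  have DeD: "De \<subseteq> D" by (auto simp: De_def)
  have pd: "d = d'" if "d \<in> D" "d' \<in> D" "x \<in> P d" "x \<in> P d'" for d d' x
    using system_disjoint(1)[OF S that(1,2)] that(3,4) by blast
  have pa: "x \<notin> P d" if "d \<in> D" "x \<in> A" for d x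
    using system_disjoint(2)[OF S that(1)] that(2) by blast
  \<comment> \<open>Thinning removes from the closed set \<open>?F1\<close> only the open parts
    \<open>P d - T d\<close>.\<close>
  have "?F2 = ?F1 - (\<Union>d\<in>D - De. P d - T d)"
  proof (intro equalityI subsetI)
    fix x assume "x \<in> ?F2"
    then consider "x \<in> A" | d where "d \<in> De" "x \<in> P d" | d where "d \<in> D - De" "x \<in> T d" by blast
    then show "x \<in> ?F1 - (\<Union>d\<in>D - De. P d - T d)"
    proof cases
      case 1
      then show ?thesis using pa by blast
    next
      case 2
      then show ?thesis using pd[of d _ x] DeD by blast
    next
      case 3
      then show ?thesis using pd[of d _ x] T(1)[of d] by blast
    qed
  next
    fix x assume "x \<in> ?F1 - (\<Union>d\<in>D - De. P d - T d)"
    then show "x \<in> ?F2" by blast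
  qed
  moreover have "openin X (\<Union>d\<in>D - De. P d - T d)"
    using system_piece(1)[OF S] T(2) by (intro openin_Union) (auto simp: clopenin_def)
  ultimately have F2: "closedin X ?F2"
    using F1 by (simp add: closedin_diff)
  have S2: "system (subtopology X ?F2) De (\<lambda>d. inv ?\<phi> (c d)) P A"
    by (rule system_subtopology[OF S _ De_def]) (auto simp: inj_def)
  obtain C2 h2 where h2: "clopenin X C2" "homeomorphic_map (subtopology X ?F2) (subtopology X C2) h2" "h2 ` ?F2 = C2"
    by (rule CO_space_copy[OF CO F2])
  obtain c2' P2 where S2': "system X (h2 ` De) c2' P2 (h2 ` A)"
    and cb2: "\<And>i. i \<in> Field (ords TYPE('a)) \<Longrightarrow> cb_level (subtopology X (h2 ` A)) i = h2 ` cb_level (subtopology X A) i"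
    by (rule system_copy[OF S2 F2 refl _ h2(1,2)]) auto
  have t2: "topspace (subtopology X ?F2) = ?F2"
    using closedin_subset[OF F2] by (simp add: inf_absorb2)
  have inj2: "inj_on h2 ?F2"
    using homeomorphic_imp_injective_map[OF h2(2)] unfolding t2 .
  have hB2: "h2 ` ?B = ?B"
    by (rule inB[OF S2' _ cb2[OF i]]) (rule inj_on_subset[OF inj2], auto)
  obtain b where b: "b \<in> ?B" using ne by blast
  then have "b \<in> h2 ` ?B" using hB2 by simp
  then obtain b0 where b0: "b0 \<in> ?B" "b = h2 b0" by (rule imageE)
  have bA: "b0 \<in> A" using b0 \<open>?B \<subseteq> A\<close> by blast
  have "openin (subtopology X C2) (C1 \<inter> C2)"
    using h1(1) by (auto simp: clopenin_def openin_subtopology)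
  then have "openin (subtopology X ?F2) {x \<in> ?F2. h2 x \<in> C1 \<inter> C2}"
    using openin_continuous_map_preimage[OF homeomorphic_imp_continuous_map[OF h2(2)], of "C1 \<inter> C2"]
    unfolding t2 by blast
  then obtain U where U: "openin X U" "{x \<in> ?F2. h2 x \<in> C1 \<inter> C2} = U \<inter> ?F2"
    by (auto simp: openin_subtopology)
  have "b \<in> C1" "b \<in> C2"
    using BC b b0 bA h2(3) by auto
  then have "b0 \<in> U"
    using U(2) bA b0 by auto
  \<comment> \<open>Colour \<open>1\<close> is one of the thinned, odd colours. Its points come
    arbitrarily close to \<open>b0\<close>, so \<open>h2\<close> carries one of them into the
    neighbourhood \<open>C1\<close> of \<open>b\<close>.\<close>
  moreover have "b0 \<in> X closure_of {d\<in>D. c d = 1}"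
    using system_closure(1)[OF S, of 1] bA by blast
  ultimately obtain d where d: "d \<in> D" "c d = 1" "d \<in> U"
    using U(1) unfolding in_closure_of by blast
  have dDe: "d \<in> D - De"
    using d by (auto simp: De_def)
  then have dF: "d \<in> ?F2" using T(3) by blast
  have "h2 d \<in> C1"
    using U(2) d(3) dF by auto
  moreover have "germ X (h2 d) (subtopology L N) e"
  proof -
    have "T d = P d \<inter> ?F2"
    proof (intro equalityI subsetI)
      fix x assume "x \<in> P d \<inter> ?F2"
      then show "x \<in> T d"
        using pa[OF d(1)] pd[OF d(1), of _ x] dDe DeD T(1) by blast
    qed (use T(1)[OF d(1)] dDe in blast)
    then have "openin (subtopology X ?F2) (T d)"
      using system_piece(1)[OF S d(1)] by (auto simp: clopenin_def openin_subtopology)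
    then have "germ (subtopology X ?F2) d (subtopology X (T d)) d"
      using T(3)[OF d(1)] by (intro germ_sym[OF germ_open_subtopology]) auto
    then have 1: "germ (subtopology X ?F2) d (subtopology L N) e"
      by (rule germ_trans[OF _ T(4)[OF d(1)]])
    have 2: "germ (subtopology X ?F2) d (subtopology X C2) (h2 d)"
      by (rule germ_homeomorphic_map[OF h2(2)]) (use dF t2 in simp)
    have 3: "germ (subtopology X C2) (h2 d) X (h2 d)"
      using h2(1,3) dF by (intro germ_open) (auto simp: clopenin_def)
    show ?thesis
      by (rule germ_trans[OF germ_sym[OF germ_trans[OF 2 3]] 1])
  qed
  ultimately show False
    using noN by blast
qed

text \<open>The tails of \<open>E\<close> are infinite and their derived sets form a chain of
  nonempty closed sets, so by compactness one point belongs to all of them. In the merged limit set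
  the tail from \<open>j\<close> on lies in stage \<open>j\<close>, hence that point reaches stage
  \<open>i\<close>. Successors use a constant \<open>\<gamma>\<close>, limits an injective
  one.\<close>

lemma limit_points_step:
  assumes i: "i \<in> Field (ords TYPE('a))" and ne: "underS (ords TYPE('a)) i \<noteq> {}"
    and E: "clopen_strong_Hausdorff_system X E V"
    and \<gamma>: "\<And>b. b \<in> E \<Longrightarrow> \<gamma> b \<in> Field (ords TYPE('a)) \<and> b \<in> limit_points (\<gamma> b)"
    and cof: "\<And>j. j \<in> underS (ords TYPE('a)) i \<Longrightarrow> infinite {b\<in>E. (j, \<gamma> b) \<in> ords TYPE('a)}"
  shows "limit_points i \<noteq> {}"
proof -
  let ?r = "ords TYPE('a)"
  interpret wo: wo_rel ?r using ords_Well_order by (simp add: wo_rel_def)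
  note V = clopen_strong_Hausdorff_systemD[OF E]
  obtain D c P A where S: "system X D c P A" "\<And>b. b \<in> E \<Longrightarrow> b \<in> cb_level (subtopology X A) (\<gamma> b)" "E \<subseteq> A"
    by (rule system_merge[OF V(2-5), of \<gamma>]) (use \<gamma> in \<open>auto simp: limit_points_def\<close>)
  let ?E = "\<lambda>j. {b\<in>E. (j, \<gamma> b) \<in> ?r}"
  let ?Q = "\<lambda>j. X derived_set_of ?E j"
  have "topspace X \<inter> \<Inter>(?Q ` underS ?r i) \<noteq> {}"
  proof -
    have fip: "\<Inter>\<F> \<noteq> {}" if F: "finite \<F>" "\<F> \<subseteq> ?Q ` underS ?r i" "\<F> \<noteq> {}" for \<F>
    proof -
      have "\<exists>j\<in>underS ?r i. ?Q j \<subseteq> \<Inter>\<F>"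
        using F(1,3,2)
      proof (induction rule: finite_ne_induct)
        case (singleton x)
        then show ?case by auto
      next
        case (insert x \<F>)
        then obtain j k where jk: "j \<in> underS ?r i" "?Q j \<subseteq> \<Inter>\<F>" "k \<in> underS ?r i" "x = ?Q k"
          by auto
        have anti: "?Q v \<subseteq> ?Q u" if "(u, v) \<in> ?r" for u v
          using wo.TRANS that by (intro derived_set_of_mono) (auto dest: transD)
        have "(j, k) \<in> ?r \<or> (k, j) \<in> ?r"
          using wo.TOTALS underS_Field'[OF ords_Well_order] jk by blast
        then show ?case
        proof
          assume "(j, k) \<in> ?r"
          from anti[OF this] jk show ?thesis
            by (intro bexI[of _ k]) auto
        next
          assume "(k, j) \<in> ?r"
          from anti[OF this] jk show ?thesis
            by (intro bexI[of _ j]) auto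
        qed
      qed
      then obtain j where j: "j \<in> underS ?r i" "?Q j \<subseteq> \<Inter>\<F>" by blast
      have "?E j \<subseteq> topspace X" using V(1) by auto
      from infinite_derived_set[OF X this cof[OF j(1)]] j(2) show ?thesis by blast
    qed
    have fip': "\<Inter>\<F> \<noteq> {}" if "finite \<F>" "\<F> \<subseteq> ?Q ` underS ?r i" for \<F>
      using fip[OF that] by (cases "\<F> = {}") auto
    have clQ: "\<forall>Q\<in>?Q ` underS ?r i. closedin X Q"
      using closedin_derived_set_of[OF Hausdorff] by blast
    have "compact_space X" using X by (simp add: scattered_compact_def)
    from this[unfolded compact_space_fip, rule_format, of "?Q ` underS ?r i"] fip' clQ
    have "\<Inter>(?Q ` underS ?r i) \<noteq> {}"
      by simp
    then obtain x where x: "x \<in> \<Inter>(?Q ` underS ?r i)" by blast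
    obtain j where "j \<in> underS ?r i" using ne by blast
    with x have "x \<in> ?Q j" by blast
    then have "x \<in> topspace X"
      using derived_set_of_subset_topspace by (rule subsetD[rotated])
    with x show ?thesis by blast
  qed
  then obtain x where x: "\<And>j. j \<in> underS ?r i \<Longrightarrow> x \<in> ?Q j" "x \<in> topspace X" by blast
  have EA: "?E j \<subseteq> A \<inter> cb_level (subtopology X A) j" for j
    using S(2,3) subsetD[OF cb_iter_antimono[OF ords_Well_order, where X = "subtopology X A" and j = j]] by auto
  have xj: "x \<in> X derived_set_of (A \<inter> cb_level (subtopology X A) j)" if "j \<in> underS ?r i" for j
    by (rule subsetD[OF derived_set_of_mono[OF EA] x(1)[OF that]])
  obtain j where "j \<in> underS ?r i" using ne by blast
  from xj[OF this] have "x \<in> X derived_set_of A"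
    using derived_set_of_mono[of "A \<inter> cb_level (subtopology X A) j" A X] by blast
  then have xA: "x \<in> A"
    using system_closed(1)[OF S(1)] by (auto simp: closedin_contains_derived_set)
  have "x \<in> cb_level (subtopology X A) i"
    unfolding in_cb_iter[OF ords_Well_order i]
    using xA x(2) xj by (auto simp: derived_set_of_subtopology)
  then show ?thesis
    using limit_pointsI[OF S(1)] by blast
qed

end

section \<open>Cofinal sets of regular cardinality\<close>

text \<open>A cofinal set of least cardinality is thinned to the elements exceeding all their predecessors
  in a well-order of that cardinality; this makes every subset of full cardinality cofinal.\<close>

lemma regular_cofinal_subset:
  assumes wo: "Well_order r" and ne: "underS r i \<noteq> {}"
    and nomax: "\<And>j. j \<in> underS r i \<Longrightarrow> \<exists>k\<in>underS r i. j \<in> underS r k"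
  obtains K where "K \<subseteq> underS r i" "infinite K" "regularCard |K|"
    "\<And>E j. E \<subseteq> K \<Longrightarrow> |E| =o |K| \<Longrightarrow> j \<in> underS r i \<Longrightarrow> infinite {k\<in>E. (j, k) \<in> r}"
proof -
  interpret wo: wo_rel r using wo by (simp add: wo_rel_def)
  let ?I = "underS r i"
  have F: "x \<in> Field r" if "x \<in> ?I" for x
    using that by (auto simp: Order_Relation.underS_def Field_def)
  have refl: "(x, x) \<in> r" if "x \<in> ?I" for x
    using F[OF that] wo.REFL by (auto simp: refl_on_def)
  have tr: "(x, z) \<in> r" if "(x, y) \<in> r" "(y, z) \<in> r" for x y z
    using wo.TRANS that by (auto dest: transD)
  have as: "x = y" if "(x, y) \<in> r" "(y, x) \<in> r" for x y
    using wo.ANTISYM that by (auto dest: antisymD)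
  have tot: "(x, y) \<in> r \<or> (y, x) \<in> r" if "x \<in> ?I" "y \<in> ?I" for x y
    using wo.TOTALS F that by blast
  have neg: "x \<noteq> y \<and> (x, y) \<in> r" if "x \<in> ?I" "y \<in> ?I" "(y, x) \<notin> r" for x y
    using tot[OF that(1,2)] that refl by auto
  define cof where "cof K \<longleftrightarrow> K \<subseteq> ?I \<and> (\<forall>j\<in>?I. \<exists>k\<in>K. (j, k) \<in> r)" for K
  \<comment> \<open>A nonempty finite set has a largest element, and \<open>nomax\<close> provides
    an index beyond it.\<close>
  have cof_infinite: "infinite K" if c: "cof K" for K
  proof
    assume "finite K"
    moreover have "K \<noteq> {}" using c ne by (auto simp: cof_def)
    moreover have "K \<subseteq> ?I" using c by (simp add: cof_def)
    ultimately have "\<exists>m\<in>K. \<forall>k\<in>K. (k, m) \<in> r"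
    proof (induction rule: finite_ne_induct)
      case (singleton x)
      then show ?case using refl by auto
    next
      case (insert x K)
      then obtain m where m: "m \<in> K" "\<forall>k\<in>K. (k, m) \<in> r" by auto
      then have "(x, m) \<in> r \<or> (m, x) \<in> r" using tot insert.prems by auto
      then show ?case
      proof
        assume "(x, m) \<in> r"
        with m show ?thesis by auto
      next
        assume "(m, x) \<in> r"
        with m have "\<forall>k\<in>insert x K. (k, x) \<in> r" using tr refl insert.prems by auto
        then show ?thesis by auto
      qed
    qed
    then obtain m where m: "m \<in> K" "\<forall>k\<in>K. (k, m) \<in> r" by blast
    have "m \<in> ?I" using m c by (auto simp: cof_def)
    from nomax[OF this] obtain k where k: "k \<in> ?I" "m \<in> underS r k" by blast
    then obtain k' where k': "k' \<in> K" "(k, k') \<in> r" using c by (auto simp: cof_def)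
    have "(m, k) \<in> r" "m \<noteq> k" using k(2) by (auto simp: Order_Relation.underS_def)
    moreover have "(k, m) \<in> r" using tr[OF k'(2)] m(2) k'(1) by blast
    ultimately show False using as by blast
  qed
  have "cof ?I" using refl by (auto simp: cof_def)
  then have "\<exists>s\<in>{|K| | K. cof K}. \<forall>s'\<in>{|K| | K. cof K}. s \<le>o s'"
    by (intro exists_minim_Card_order) (auto simp: card_of_Card_order)
  then obtain K0 where K0: "cof K0" and min: "\<And>K. cof K \<Longrightarrow> |K0| \<le>o |K|" by blast
  let ?k = "|K0|"
  have kF: "Field ?k = K0" by (rule Field_card_of)
  have kwo: "Well_order ?k" by (rule card_of_Well_order)
  interpret k: wo_rel ?k using kwo by (simp add: wo_rel_def)
  define K where "K = {x\<in>K0. \<forall>y\<in>underS ?k x. y \<in> underS r x}"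
  have KI: "K \<subseteq> ?I" using K0 by (auto simp: K_def cof_def)
  have cofK: "cof K"
    unfolding cof_def
  proof (intro conjI ballI KI)
    fix j assume j: "j \<in> ?I"
    let ?S = "{x\<in>K0. (j, x) \<in> r}"
    have S: "?S \<subseteq> Field ?k" "?S \<noteq> {}" using K0 j by (auto simp: kF cof_def)
    let ?x = "k.minim ?S"
    have x: "?x \<in> ?S" by (rule k.minim_in[OF S])
    \<comment> \<open>\<open>?x\<close> is the first element of \<open>K0\<close> in the order
      \<open>?k\<close> that is at least \<open>j\<close>; its predecessors in \<open>?k\<close> are
      therefore strictly below \<open>j\<close> in \<open>r\<close>.\<close>
    have "?x \<in> K"
      unfolding K_def
    proof (intro CollectI conjI ballI)
      show "?x \<in> K0" using x by blast
      fix y assume y: "y \<in> underS ?k ?x"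
      then have yK: "y \<in> K0" using kF by (auto simp: Order_Relation.underS_def Field_def)
      have "y \<notin> ?S"
      proof
        assume "y \<in> ?S"
        then have "(?x, y) \<in> ?k" using k.minim_least[OF S(1)] by blast
        moreover have "(y, ?x) \<in> ?k" "y \<noteq> ?x" using y by (auto simp: Order_Relation.underS_def)
        ultimately show False using antisymD[OF k.ANTISYM] by metis
      qed
      then have "y \<noteq> j \<and> (y, j) \<in> r" using neg[of y j] yK K0 j by (auto simp: cof_def)
      moreover have "(j, ?x) \<in> r" using x by blast
      ultimately show "y \<in> underS r ?x"
        using tr[of y j ?x] as[of j y] by (auto simp: Order_Relation.underS_def)
    qed
    with x show "\<exists>k\<in>K. (j, k) \<in> r" by blast
  qed
  have iso: "|K| =o |K0|"
    using min[OF cofK] card_of_mono1[of K K0] by (auto simp: K_def ordIso_iff_ordLeq)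
  \<comment> \<open>On \<open>K\<close> the orders \<open>r\<close> and \<open>?k\<close> agree. A
    subset bounded by \<open>j\<close> lies below some \<open>x\<close> of \<open>K\<close>, hence
    in a proper initial segment of the cardinal \<open>?k\<close>, and is smaller than
    \<open>K\<close>.\<close>
  have big: "cof E" if E: "E \<subseteq> K" "|E| =o |K|" for E
  proof (rule ccontr)
    assume "\<not> cof E"
    then obtain j where j: "j \<in> ?I" "\<And>k. k \<in> E \<Longrightarrow> (j, k) \<notin> r"
      using E(1) KI by (auto simp: cof_def)
    obtain x where x: "x \<in> K" "(j, x) \<in> r" using cofK j(1) by (auto simp: cof_def)
    have "E \<subseteq> underS ?k x"
    proof
      fix y assume y: "y \<in> E"
      then have yK: "y \<in> K" using E by blast
      have "y \<noteq> j" "(y, j) \<in> r" using neg[of y j] j y yK KI by auto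
      then have yx: "y \<noteq> x" "(y, x) \<in> r" using x(2) tr as by blast+
      have "(x, y) \<in> ?k \<or> (y, x) \<in> ?k"
        using k.TOTALS x(1) yK by (auto simp: kF K_def)
      moreover have "x \<notin> underS ?k y"
        using yK yx as[of x y] by (auto simp: K_def Order_Relation.underS_def)
      ultimately show "y \<in> underS ?k x"
        using yx by (auto simp: Order_Relation.underS_def)
    qed
    then have "|E| \<le>o |underS ?k x|" by (rule card_of_mono1)
    also have "|underS ?k x| <o ?k"
      using x(1) by (intro card_of_underS card_of_Card_order) (simp add: kF K_def)
    finally have "|E| <o |K0|" .
    moreover have "|E| =o |K0|" using E(2) iso by (rule ordIso_transitive)
    ultimately show False using not_ordLess_ordIso by blast
  qed
  have reg: "regularCard |K|"
    unfolding regularCard_def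
  proof (intro allI impI, elim conjE)
    fix K' assume K': "K' \<subseteq> Field |K|" "cofinal K' |K|"
    have "|K'| \<le>o |K|" using K'(1) by (simp add: card_of_mono1 Field_card_of)
    moreover have "\<not> |K'| <o |K|"
    proof
      assume less: "|K'| <o |K|"
      \<comment> \<open>If \<open>K'\<close> were smaller than \<open>K\<close>, minimality of
        \<open>K0\<close> would apply twice: an initial segment of \<open>|K|\<close> below a point
        \<open>b\<close> of \<open>K'\<close> is too small to be cofinal and is bounded by some
        \<open>z b\<close>, and then so is the set of all \<open>z b\<close>. But \<open>K\<close>
        exceeds that last bound, while \<open>K'\<close> is cofinal in \<open>|K|\<close>.\<close>
      have "\<exists>z\<in>?I. \<forall>k\<in>underS |K| b. (z, k) \<notin> r" if b: "b \<in> K'" for b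
      proof (rule ccontr)
        assume neg: "\<not> ?thesis"
        have "underS |K| b \<subseteq> K"
          using Order_Relation.underS_Field[of "|K|" b] by (simp add: Field_card_of)
        then have "cof (underS |K| b)" using neg KI by (auto simp: cof_def)
        from min[OF this] have "|K| \<le>o |underS |K| b|" using iso ordIso_ordLeq_trans by blast
        moreover have "|underS |K| b| <o |K|"
          using b K'(1) by (intro card_of_underS card_of_Card_order) auto
        ultimately show False using not_ordLess_ordLeq by blast
      qed
      then have "\<forall>b\<in>K'. \<exists>z. z \<in> ?I \<and> (\<forall>k\<in>underS |K| b. (z, k) \<notin> r)" by blast
      from bchoice[OF this] obtain z where z: "\<And>b. b \<in> K' \<Longrightarrow> z b \<in> ?I" 
        "\<And>b k. b \<in> K' \<Longrightarrow> k \<in> underS |K| b \<Longrightarrow> (z b, k) \<notin> r" by blast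
      have "\<not> cof (z ` K')"
      proof
        assume "cof (z ` K')"
        from min[OF this] have "|K0| \<le>o |K'|" using card_of_image ordLeq_transitive by blast
        then have "|K| \<le>o |K'|" using iso ordIso_ordLeq_trans by blast
        with less show False using not_ordLess_ordLeq by blast
      qed
      then obtain j where j: "j \<in> ?I" "\<And>b. b \<in> K' \<Longrightarrow> (j, z b) \<notin> r"
        using z(1) by (auto simp: cof_def)
      obtain x where x: "x \<in> K" "(j, x) \<in> r" using cofK j(1) by (auto simp: cof_def)
      then obtain b where b: "b \<in> K'" "x \<noteq> b" "(x, b) \<in> |K|"
        using K'(2) by (auto simp: cofinal_def Field_card_of)
      then have "(z b, x) \<notin> r" using z(2)[of b x] by (simp add: Order_Relation.underS_def)
      moreover have "(z b, j) \<in> r" using neg[OF z(1)[OF b(1)] j(1)] j(2)[OF b(1)] by blast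
      ultimately show False using tr x(2) by blast
    qed
    ultimately show "|K'| =o |K|"
      using ordLeq_iff_ordLess_or_ordIso by blast
  qed
  show ?thesis
  proof (rule that[OF KI cof_infinite[OF cofK] reg])
    fix E j assume E: "E \<subseteq> K" "|E| =o |K|" and j: "j \<in> ?I"
    note cE = big[OF E]
    have "cof {k\<in>E. (j, k) \<in> r}"
      unfolding cof_def
    proof (intro conjI ballI)
      show "{k\<in>E. (j, k) \<in> r} \<subseteq> ?I" using E(1) KI by blast
      fix z assume z: "z \<in> ?I"
      from tot[OF z j] show "\<exists>k\<in>{k\<in>E. (j, k) \<in> r}. (z, k) \<in> r"
      proof
        assume "(z, j) \<in> r"
        moreover obtain k where "k \<in> E" "(j, k) \<in> r" using cE j by (auto simp: cof_def)
        ultimately show ?thesis using tr by blast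
      next
        assume "(j, z) \<in> r"
        moreover obtain k where "k \<in> E" "(z, k) \<in> r" using cE z by (auto simp: cof_def)
        ultimately show ?thesis using tr by blast
      qed
    qed
    then show "infinite {k\<in>E. (j, k) \<in> r}" by (rule cof_infinite)
  qed
qed

lemma regularCard_image:
  assumes "inj_on f K" "infinite K" "regularCard |K|"
  shows "regularCard |f ` K|" "|f ` K| =o |K|"
proof -
  have "|K| =o |f ` K|"
    using assms(1) by (intro card_of_ordIsoI[of f]) (simp add: bij_betw_def)
  then show "|f ` K| =o |K|" by (rule ordIso_symmetric)
  show "regularCard |f ` K|"
    by (rule regularCard_ordIso[OF \<open>|K| =o |f ` K|\<close> _ assms(3)])
      (simp add: cinfinite_def Field_card_of card_of_card_order_on assms(2))
qed

lemma regularCard_UNIV_nat: "regularCard |UNIV :: nat set|"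
  by (rule regularCard_ordIso[OF ordIso_symmetric[OF card_of_nat] natLeq_Cinfinite regularCard_natLeq])

section \<open>Limit points of every rank\<close>

context CO_germ_pair
begin

text \<open>With \<open>j\<close> the last index before \<open>i\<close>, every infinite subset of
  \<open>limit_points j\<close> serves as a cofinal one, so a countable set suffices, and its
  cardinality is regular.\<close>

lemma limit_points_successor:
  assumes i: "i \<in> Field (ords TYPE('a))" and j: "j \<in> underS (ords TYPE('a)) i"
    and max: "\<And>k. k \<in> underS (ords TYPE('a)) i \<Longrightarrow> (k, j) \<in> ords TYPE('a)"
    and ne: "limit_points j \<noteq> {}"
  shows "limit_points i \<noteq> {}"
proof -
  have jF: "j \<in> Field (ords TYPE('a))" by (rule underS_Field'[OF ords_Well_order j])
  obtain f :: "nat \<Rightarrow> 'a" where f: "inj f" "range f \<subseteq> limit_points j"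
    using infinite_countable_subset[OF limit_points_infinite[OF jF ne]] by blast
  have inf: "infinite (range f)" using f(1) by (simp add: finite_image_iff)
  obtain E V where E: "E \<subseteq> range f" "|E| =o |range f|" "clopen_strong_Hausdorff_system X E V"
    using SH[OF _ inf regularCard_image(1)[OF f(1) infinite_UNIV_nat regularCard_UNIV_nat]] 
      f(2) limit_points_subset[OF jF] by (meson subset_trans)
  have "infinite E" using inf card_of_ordIso_finite[OF E(2)] by simp
  show ?thesis
  proof (rule limit_points_step[OF i _ E(3), of "\<lambda>_. j"])
    show "underS (ords TYPE('a)) i \<noteq> {}" using j by blast
    show "j \<in> Field (ords TYPE('a)) \<and> b \<in> limit_points j" if "b \<in> E" for b
      using that E(1) f(2) jF by blast
    show "infinite {b \<in> E. (k, j) \<in> ords TYPE('a)}" if "k \<in> underS (ords TYPE('a)) i" for k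
      using max[OF that] \<open>infinite E\<close> by simp
  qed
qed

text \<open>Points taken in \<open>limit_points j\<close> but in no later set are distinct for
  distinct \<open>j\<close>, so a set of indices of regular cardinality yields points of the same
  cardinality, to which \<open>SH\<close> applies. The subset obtained has full size, hence its
  indices remain cofinal.\<close>

lemma limit_points_limit:
  assumes i: "i \<in> Field (ords TYPE('a))" and I: "underS (ords TYPE('a)) i \<noteq> {}"
    and nomax: "\<And>j. j \<in> underS (ords TYPE('a)) i \<Longrightarrow> \<exists>k\<in>underS (ords TYPE('a)) i. j \<in> underS (ords TYPE('a)) k"
    and ne: "\<And>j. j \<in> underS (ords TYPE('a)) i \<Longrightarrow> limit_points j \<noteq> {}"
  shows "limit_points i \<noteq> {}"
proof -
  let ?r = "ords TYPE('a)"
  interpret wo: wo_rel ?r using ords_Well_order by (simp add: wo_rel_def)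
  have jF: "j \<in> Field ?r" if "j \<in> underS ?r i" for j
    by (rule underS_Field'[OF ords_Well_order that])
  have "\<exists>b. b \<in> limit_points j \<and> (\<forall>k\<in>Field ?r. j \<in> underS ?r k \<longrightarrow> b \<notin> limit_points k)"
    if j: "j \<in> underS ?r i" for j
    using limit_points_exact[OF jF[OF j] ne[OF j]] by metis
  then have "\<forall>j\<in>underS ?r i. \<exists>b. b \<in> limit_points j \<and> (\<forall>k\<in>Field ?r. j \<in> underS ?r k \<longrightarrow> b \<notin> limit_points k)"
    by blast
  from bchoice[OF this] obtain f where f: "\<And>j. j \<in> underS ?r i \<Longrightarrow> f j \<in> limit_points j"
    "\<And>j k. j \<in> underS ?r i \<Longrightarrow> k \<in> Field ?r \<Longrightarrow> j \<in> underS ?r k \<Longrightarrow> f j \<notin> limit_points k"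
    by blast
  have inj: "inj_on f (underS ?r i)"
  proof (rule inj_onI, rule ccontr)
    fix j k assume jk: "j \<in> underS ?r i" "k \<in> underS ?r i" "f j = f k" "j \<noteq> k"
    then have "j \<in> underS ?r k \<or> k \<in> underS ?r j"
      using wo.TOTALS jF by (auto simp: Order_Relation.underS_def)
    then show False
      using f(2)[of j k] f(2)[of k j] f(1)[of j] f(1)[of k] jk jF by auto
  qed
  obtain K where K: "K \<subseteq> underS ?r i" "infinite K" "regularCard |K|"
    and cof: "\<And>E j. E \<subseteq> K \<Longrightarrow> |E| =o |K| \<Longrightarrow> j \<in> underS ?r i \<Longrightarrow> infinite {k\<in>E. (j, k) \<in> ?r}"
    by (rule regular_cofinal_subset[OF ords_Well_order I nomax]) (assumption, rule that)
  have injK: "inj_on f K" using inj K(1) by (rule inj_on_subset)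
  have "f ` K \<subseteq> topspace X"
    using f(1) K(1) limit_points_subset[OF jF] by blast
  moreover have "infinite (f ` K)" using K(2) injK by (simp add: finite_image_iff)
  ultimately obtain E V where E: "E \<subseteq> f ` K" "|E| =o |f ` K|" "clopen_strong_Hausdorff_system X E V"
    using SH[OF _ _ regularCard_image(1)[OF injK K(2,3)]] by blast
  define E' where "E' = {k\<in>K. f k \<in> E}"
  have E'E: "E = f ` E'" using E(1) by (auto simp: E'_def)
  have injE': "inj_on f E'" using injK by (rule inj_on_subset) (auto simp: E'_def)
  have "|E'| =o |E|"
    using injE' E'E by (intro card_of_ordIsoI[of f]) (simp add: bij_betw_def)
  from ordIso_transitive[OF ordIso_transitive[OF this E(2)] regularCard_image(2)[OF injK K(2,3)]]
  have card: "|E'| =o |K|" .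
  define \<gamma> where "\<gamma> = the_inv_into K f"
  have \<gamma>: "\<gamma> (f k) = k" if "k \<in> K" for k
    unfolding \<gamma>_def by (rule the_inv_into_f_f[OF injK that])
  show ?thesis
  proof (rule limit_points_step[OF i I E(3), of \<gamma>])
    show "\<gamma> b \<in> Field ?r \<and> b \<in> limit_points (\<gamma> b)" if "b \<in> E" for b
    proof -
      obtain k where k: "k \<in> K" "b = f k" using \<open>b \<in> E\<close> E(1) by blast
      then have "k \<in> underS ?r i" using K(1) by blast
      then show ?thesis using jF f(1) \<gamma>[OF k(1)] k(2) by simp
    qed
    fix j assume j: "j \<in> underS ?r i"
    have "f ` {k\<in>E'. (j, k) \<in> ?r} \<subseteq> {b \<in> E. (j, \<gamma> b) \<in> ?r}"
      using \<gamma> by (auto simp: E'_def)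
    moreover have "inj_on f {k\<in>E'. (j, k) \<in> ?r}"
      using injE' by (rule inj_on_subset) blast
    then have "infinite (f ` {k\<in>E'. (j, k) \<in> ?r})"
      using cof[OF _ card j] by (simp add: finite_image_iff E'_def)
    ultimately show "infinite {b \<in> E. (j, \<gamma> b) \<in> ?r}"
      by (rule infinite_super)
  qed
qed

lemma no_nontrivial_system:
  assumes S: "system X D c P A" and A: "A \<noteq> {}"
  shows False
proof -
  let ?r = "ords TYPE('a)"
  interpret wo: wo_rel ?r using ords_Well_order by (simp add: wo_rel_def)
  have ne: "limit_points i \<noteq> {}" if "i \<in> Field ?r" for i
    using that
  proof (induction rule: cb_iter_induct[OF ords_Well_order, consumes 1])
    case (1 i)
    show ?case
    proof (cases "underS ?r i = {}")
      case True
      obtain x where "x \<in> A" using A by blast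
      moreover have "A \<subseteq> topspace X" using system_closed(1)[OF S] closedin_subset by blast
      ultimately have "x \<in> cb_level (subtopology X A) i"
        using True by (auto simp: in_cb_iter[OF ords_Well_order 1(1)])
      then show ?thesis using limit_pointsI[OF S] by blast
    next
      case ne: False
      show ?thesis
      proof (cases "\<exists>j\<in>underS ?r i. \<forall>k\<in>underS ?r i. (k, j) \<in> ?r")
        case True
        then obtain j where j: "j \<in> underS ?r i" "\<And>k. k \<in> underS ?r i \<Longrightarrow> (k, j) \<in> ?r" by blast
        from limit_points_successor[OF 1(1) j 1(2)[OF j(1)]] show ?thesis .
      next
        case False
        have "\<exists>k\<in>underS ?r i. j \<in> underS ?r k" if j: "j \<in> underS ?r i" for j
        proof -
          obtain k where k: "k \<in> underS ?r i" "(k, j) \<notin> ?r" using False j by blast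
          have F: "j \<in> Field ?r" "k \<in> Field ?r"
            using underS_Field'[OF ords_Well_order j] underS_Field'[OF ords_Well_order k(1)] by simp_all
          then have "(j, k) \<in> ?r" "j \<noteq> k"
            using wo.TOTALS k(2) by auto
          with k show ?thesis by (auto simp: Order_Relation.underS_def)
        qed
        from limit_points_limit[OF 1(1) ne this 1(2)] show ?thesis .
      qed
    qed
  qed
  obtain i where i: "i \<in> Field ?r" "finite (cb_level X i)"
    using cb_iter_finite[OF X] by blast
  have "limit_points i \<subseteq> cb_level X i"
  proof
    fix b assume "b \<in> limit_points i"
    then obtain D c P A where S: "system X D c P A" "b \<in> cb_level (subtopology X A) i"
      unfolding limit_points_def by blast
    then have "b \<in> cb_level (subtopology X (topspace X)) i"
      using cb_iter_mono[OF ords_Well_order i(1) closedin_subset[OF system_closed(1)[OF S(1)]], of X] by blast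
    then show "b \<in> cb_level X i" by simp
  qed
  then have "finite (limit_points i)" using i(2) by (rule finite_subset)
  with limit_points_infinite[OF i(1) ne[OF i(1)]] show False by simp
qed

end

section \<open>Sequences of points of one type\<close>

context CO_germ_pair
begin

text \<open>\<open>x\<close> is isolated in stage \<open>a\<close> of \<Lambda>, so a small clopen
  part of \<Lambda> has no other point of that stage, as is required of a piece.\<close>

lemma germ_closed_shrink:
  assumes \<Lambda>: "closedin X \<Lambda>" "germ (subtopology X \<Lambda>) x L e"
  obtains T where "closedin X T" "x \<in> T" "germ (subtopology X T) x L e" "cb_level (subtopology X T) a = {x}"
proof -
  have x: "x \<in> cb_level (subtopology X \<Lambda>) a" "x \<notin> subtopology X \<Lambda> derived_set_of cb_level (subtopology X \<Lambda>) a"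
    using germ_rank[of "subtopology X \<Lambda>" x] \<Lambda>(2) by auto
  have x\<Lambda>: "x \<in> \<Lambda>" using germ_topspace(1)[OF \<Lambda>(2)] by simp
  obtain U where U: "openin (subtopology X \<Lambda>) U" "x \<in> U" "\<And>y. y \<in> cb_level (subtopology X \<Lambda>) a \<Longrightarrow> y \<in> U \<Longrightarrow> y = x"
    using x germ_topspace(1)[OF \<Lambda>(2)] unfolding in_derived_set_of by blast
  obtain W where W: "clopenin (subtopology X \<Lambda>) W" "x \<in> W" "W \<subseteq> U"
    by (rule scattered_compact_clopen_base[OF scattered_compact_subtopology[OF X \<Lambda>(1)] U(1,2)])
  have o: "openin (subtopology X \<Lambda>) W" using W(1) by (simp add: clopenin_def)
  have eq: "subtopology (subtopology X \<Lambda>) W = subtopology X W"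
    using openin_imp_subset[OF o] by (simp add: subtopology_subtopology inf_absorb2)
  show ?thesis
  proof (rule that[of W])
    show "closedin X W"
      using W(1) \<Lambda>(1) closedin_trans_full by (auto simp: clopenin_def)
    show "germ (subtopology X W) x L e"
      by (rule germ_trans[OF germ_open_subtopology[OF o W(2)] \<Lambda>(2)])
    show "cb_level (subtopology X W) a = {x}"
      using cb_iter_open[OF ords_Well_order a o] eq U(3) W(2,3) x(1) by auto
  qed (rule W(2))
qed

text \<open>The end of a closed copy of \<open>L\<close> need not have type \<open>L\<close> in
  \<open>X\<close> itself. The system is therefore built in a closed subspace \<open>F\<close>, made
  of parts of the copies and one limit point, and then carried into \<open>X\<close> by the CO
  property.\<close>

lemma finitely_many_closed_germs:
  "finite {x. \<exists>\<Lambda>. closedin X \<Lambda> \<and> germ (subtopology X \<Lambda>) x L e}" (is "finite ?Z")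
proof (rule ccontr)
  assume inf: "infinite ?Z"
  obtain f :: "nat \<Rightarrow> 'a" where f: "inj f" "range f \<subseteq> ?Z"
    using infinite_countable_subset[OF inf] by blast
  have inff: "infinite (range f)" using f(1) by (simp add: finite_image_iff)
  have "?Z \<subseteq> topspace X"
  proof
    fix x assume "x \<in> ?Z"
    then obtain \<Lambda> where "germ (subtopology X \<Lambda>) x L e" by blast
    from germ_topspace(1)[OF this] show "x \<in> topspace X" by simp
  qed
  with f(2) have "range f \<subseteq> topspace X" by (rule subset_trans)
  from SH[OF this inff regularCard_image(1)[OF f(1) infinite_UNIV_nat regularCard_UNIV_nat]]
  obtain D V where D: "D \<subseteq> range f" "|D| =o |range f|" and SHD: "clopen_strong_Hausdorff_system X D V"
    by blast
  note V = clopen_strong_Hausdorff_systemD[OF SHD]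
  have infD: "infinite D" using inff card_of_ordIso_finite[OF D(2)] by simp
  have Dpt: "D \<inter> V d = {d}" if "d \<in> D" for d
    using V(3,4) that by (fastforce simp: disjoint_family_on_def)
  have not_derived: "x \<notin> V d" if "x \<in> X derived_set_of S" "S \<subseteq> D" "d \<in> D" for x S d
  proof
    assume "x \<in> V d"
    moreover have "openin X (V d)" using V(2)[OF that(3)] by (simp add: clopenin_def)
    ultimately have "infinite (S \<inter> V d)"
      using that(1) derived_set_of_infinite_openin[OF Hausdorff, of S] by blast
    moreover have "S \<inter> V d \<subseteq> {d}" using Dpt[OF that(3)] that(2) by blast
    ultimately show False using finite_subset by blast
  qed
  \<comment> \<open>These are exactly the accumulation points of \<open>D\<close>; isolating one of
    them by a clopen \<open>W\<close> leaves \<open>b\<close> as the only one for the part of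
    \<open>D\<close> in \<open>W\<close>.\<close>
  let ?A = "X closure_of D - \<Union>(V ` D)"
  have der: "x \<in> ?A" if "x \<in> X derived_set_of S" "S \<subseteq> D" for x S
  proof -
    have "x \<in> X derived_set_of D" using derived_set_of_mono[OF that(2), of X] that(1) by blast
    then have "x \<in> X closure_of D" by (rule subsetD[OF derived_set_of_subset_closure_of])
    then show ?thesis using not_derived[OF that] by blast
  qed
  have "?A \<noteq> {}"
    using infinite_derived_set[OF X V(1) infD] der[OF _ subset_refl] by blast
  moreover have "?A \<subseteq> topspace X" using closure_of_subset_topspace[of X D] by blast
  ultimately obtain b W where W: "clopenin X W" "W \<inter> ?A = {b}"
    using scattered_compact_isolated_point[OF X] by metis
  have oW: "openin X W" and cW: "closedin X W" using W(1) by (auto simp: clopenin_def)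
  have bD: "b \<notin> D" using W(2) V(3) by blast
  have bW: "b \<in> W" and bcl: "b \<in> X closure_of D" using W(2) by blast+
  define E where "E = D \<inter> W"
  have ED: "E \<subseteq> D" by (simp add: E_def)
  have infE: "infinite E"
  proof -
    have "b \<in> X derived_set_of D" using bcl bD by (auto simp: closure_of)
    then show ?thesis
      using derived_set_of_infinite_openin[OF Hausdorff, of D] oW bW unfolding E_def by blast
  qed
  \<comment> \<open>Every infinite subset of \<open>E\<close> accumulates at \<open>b\<close>, so
    any splitting of \<open>E\<close> into infinite classes is a valid colouring.\<close>
  have lim: "b \<in> X closure_of S" if S: "S \<subseteq> E" "infinite S" for S
  proof -
    have "S \<subseteq> topspace X" using S(1) ED V(1) by blast
    from infinite_derived_set[OF X this S(2)] obtain x where x: "x \<in> X derived_set_of S" by blast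
    have "x \<in> X closure_of S" by (rule subsetD[OF derived_set_of_subset_closure_of x])
    moreover have "X closure_of S \<subseteq> W"
      using S(1) cW by (intro closure_of_minimal) (auto simp: E_def)
    ultimately have "x \<in> W \<inter> ?A" using der[OF x] S(1) ED by blast
    with W(2) \<open>x \<in> X closure_of S\<close> show ?thesis by simp
  qed
  \<comment> \<open>\<open>E\<close> is countable as a subset of \<open>range f\<close>; numbering
    it and decoding the numbers as pairs, the first coordinate has infinite fibres.\<close>
  obtain c :: "'a \<Rightarrow> nat" where c: "\<And>n. infinite {d\<in>E. c d = n}"
  proof -
    have "countable E"
      using ED D(1) countable_subset[of E "range f"] by auto
    then have bij: "bij_betw (to_nat_on E) E UNIV"
      using infE by (rule to_nat_on_infinite)
    define c where "c d = fst (prod_decode (to_nat_on E d))" for d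
    have "infinite {d\<in>E. c d = n}" for n
    proof -
      let ?g = "\<lambda>m. inv_into E (to_nat_on E) (prod_encode (n, m))"
      have g: "?g m \<in> E" "to_nat_on E (?g m) = prod_encode (n, m)" for m
        using bij by (auto simp: bij_betw_def inv_into_into f_inv_into_f)
      have "inj ?g"
      proof (rule injI)
        fix m m' assume "?g m = ?g m'"
        then have "prod_encode (n, m) = prod_encode (n, m')" using g(2) by metis
        then show "m = m'" by (simp add: prod_encode_eq)
      qed
      then have "infinite (range ?g)" by (simp add: finite_image_iff)
      moreover have "range ?g \<subseteq> {d\<in>E. c d = n}"
        using g by (auto simp: c_def)
      ultimately show ?thesis by (rule infinite_super[rotated])
    qed
    then show ?thesis by (rule that)
  qed
  have "\<forall>d\<in>D. \<exists>T. closedin X T \<and> d \<in> T \<and> germ (subtopology X T) d L e \<and> cb_level (subtopology X T) a = {d}"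
  proof
    fix d assume "d \<in> D"
    then have "d \<in> ?Z" using D(1) f(2) by blast
    then obtain \<Lambda> where "closedin X \<Lambda>" "germ (subtopology X \<Lambda>) d L e" by blast
    from germ_closed_shrink[OF this]
    show "\<exists>T. closedin X T \<and> d \<in> T \<and> germ (subtopology X T) d L e \<and> cb_level (subtopology X T) a = {d}" by metis
  qed
  from bchoice[OF this] obtain \<Lambda> where \<Lambda>: "\<And>d. d \<in> D \<Longrightarrow> closedin X (\<Lambda> d)" "\<And>d. d \<in> D \<Longrightarrow> d \<in> \<Lambda> d"
    "\<And>d. d \<in> D \<Longrightarrow> germ (subtopology X (\<Lambda> d)) d L e" "\<And>d. d \<in> D \<Longrightarrow> cb_level (subtopology X (\<Lambda> d)) a = {d}"
    by blast
  \<comment> \<open>Intersecting with \<open>W\<close> keeps the closure of any union of pieces in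
    \<open>W\<close>, where \<open>b\<close> is the only point of \<open>?A\<close>.\<close>
  define Q where "Q d = \<Lambda> d \<inter> (V d \<inter> W)" for d
  have Vd: "d = d'" if "d \<in> D" "d' \<in> D" "x \<in> V d" "x \<in> V d'" for d d' x
    using V(4) that by (auto simp: disjoint_family_on_def)
  have QV: "Q d \<subseteq> V d" and QW: "Q d \<subseteq> W" for d by (auto simp: Q_def)
  have dQ: "d \<in> Q d" if "d \<in> E" for d using that \<Lambda>(2) V(3) by (auto simp: Q_def E_def)
  have bV: "b \<notin> V d" if "d \<in> D" for d using W(2) that by blast
  have closedQ: "closedin X ({b} \<union> \<Union>(Q ` S))" if S: "S \<subseteq> E" for S
  proof -
    have SD: "S \<subseteq> D" using S ED by blast
    have Qc: "closedin X (Q d)" if "d \<in> D" for d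
      using \<Lambda>(1)[OF that] V(2)[OF that] W(1) by (auto simp: Q_def clopenin_def)
    have "X closure_of (\<Union>(Q ` S)) \<subseteq> {b} \<union> \<Union>(Q ` S)"
    proof
      fix x assume x: "x \<in> X closure_of (\<Union>(Q ` S))"
      have "X closure_of (\<Union>(Q ` S)) \<subseteq> W"
        using QW cW by (intro closure_of_minimal) auto
      then have xW: "x \<in> W" using x by blast
      have "\<Union>(Q ` S) \<subseteq> \<Union>(V ` D)" using QV SD by blast
      from closure_of_mono[OF this, of X] V(5) x have "x \<in> \<Union>(V ` D) \<union> X closure_of D" by blast
      then consider d where "d \<in> D" "x \<in> V d" | "x \<in> ?A" by blast
      then show "x \<in> {b} \<union> \<Union>(Q ` S)"
      proof cases
        case 1
        have "x \<in> X closure_of (\<Union>(Q ` S) \<inter> V d)"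
          using V(2)[OF 1(1)] 1(2) x by (intro in_closure_of_Int_open) (auto simp: clopenin_def)
        moreover have "\<Union>(Q ` S) \<inter> V d \<subseteq> (if d \<in> S then Q d else {})"
        proof
          fix y assume "y \<in> \<Union>(Q ` S) \<inter> V d"
          then obtain d' where d': "d' \<in> S" "y \<in> Q d'" "y \<in> V d" by blast
          have "d' = d" by (rule Vd[of d' d y]) (use d' SD 1(1) QV in blast)+
          with d' show "y \<in> (if d \<in> S then Q d else {})" by simp
        qed
        ultimately have "x \<in> X closure_of (if d \<in> S then Q d else {})"
          by (rule subsetD[OF closure_of_mono, rotated])
        then show ?thesis
          using closure_of_closedin[OF Qc[OF 1(1)]] by (auto split: if_splits)
      next
        case 2
        with xW W(2) show ?thesis by blast
      qed
    qed
    moreover have "closedin X {b}"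
      using clopenin_subset[OF W(1)] bW by (intro closedin_Hausdorff_finite[OF Hausdorff]) auto
    ultimately have "X closure_of ({b} \<union> \<Union>(Q ` S)) \<subseteq> {b} \<union> \<Union>(Q ` S)"
      unfolding closure_of_Un by (simp add: closure_of_closedin)
    moreover have "{b} \<union> \<Union>(Q ` S) \<subseteq> topspace X"
      using QW bW clopenin_subset[OF W(1)] by blast
    ultimately show ?thesis using closure_of_subset_eq by blast
  qed
  define F where "F = {b} \<union> \<Union>(Q ` E)"
  have F: "closedin X F" unfolding F_def by (rule closedQ) simp
  have QF: "Q d = V d \<inter> F" if d: "d \<in> E" for d
  proof
    show "Q d \<subseteq> V d \<inter> F" using QV d by (auto simp: F_def)
    show "V d \<inter> F \<subseteq> Q d"
    proof
      fix x assume x: "x \<in> V d \<inter> F"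
      have dD: "d \<in> D" using d ED by blast
      have "x \<noteq> b" using bV[OF dD] x by blast
      then obtain d' where d': "d' \<in> E" "x \<in> Q d'" using x by (auto simp: F_def)
      have "d' = d" by (rule Vd[of d' d x]) (use d' dD ED QV x in blast)+
      with d' show "x \<in> Q d" by simp
    qed
  qed
  have S: "system (subtopology X F) E c Q {b}"
    unfolding system_def
  proof (intro conjI ballI allI)
    fix d assume d: "d \<in> E"
    then have dD: "d \<in> D" using ED by blast
    show cl: "clopenin (subtopology X F) (Q d)"
      unfolding QF[OF d] by (rule clopenin_subtopology_Int[OF V(2)[OF dD]])
    have o: "openin (subtopology X F) (Q d)" using cl by (simp add: clopenin_def)
    have o': "openin (subtopology X (\<Lambda> d)) (Q d)"
    proof -
      have "openin X (V d \<inter> W)" using V(2)[OF dD] oW by (auto simp: clopenin_def)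
      then show ?thesis unfolding Q_def by (rule openin_subtopology_Int2)
    qed
    have eq: "subtopology (subtopology X F) (Q d) = subtopology X (Q d)" 
      "subtopology (subtopology X (\<Lambda> d)) (Q d) = subtopology X (Q d)"
      using openin_imp_subset[OF o] openin_imp_subset[OF o'] by (simp_all add: subtopology_subtopology inf_absorb2)
    have "Q d \<inter> cb_level (subtopology X F) a = Q d \<inter> cb_level (subtopology X (\<Lambda> d)) a"
      using cb_iter_open[OF ords_Well_order a o] cb_iter_open[OF ords_Well_order a o'] unfolding eq by simp
    then show "Q d \<inter> cb_level (subtopology X F) a = {d}"
      using \<Lambda>(4)[OF dD] dQ[OF d] by simp
    show "germ (subtopology X F) d L e"
      by (rule germ_trans[OF germ_sym[OF germ_open_subtopology[OF o dQ[OF d]]]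
            germ_trans[OF germ_open_subtopology[OF o' dQ[OF d]] \<Lambda>(3)[OF dD]]])
  next
    show "disjoint_family_on Q E"
      unfolding disjoint_family_on_def
    proof (intro ballI impI equals0I)
      fix d d' x assume d: "d \<in> E" "d' \<in> E" "d \<noteq> d'" "x \<in> Q d \<inter> Q d'"
      have "d = d'" by (rule Vd[of d d' x]) (use d ED QV in blast)+
      with d(3) show False by simp
    qed
    have "b \<notin> Q d" if "d \<in> E" for d
      using bV[of d] that QV[of d] ED by blast
    then show "{b} \<inter> \<Union>(Q ` E) = {}" by simp
  next
    fix J
    show "closedin (subtopology X F) ({b} \<union> \<Union>(Q ` {d \<in> E. c d \<in> J}))"
      by (rule closedin_subset_topspace[OF closedQ]) (auto simp: F_def)
  next
    fix n
    have "F \<inter> {d\<in>E. c d = n} = {d\<in>E. c d = n}" using dQ by (auto simp: F_def)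
    then show "{b} \<subseteq> subtopology X F closure_of {d \<in> E. c d = n}"
      using lim[OF _ c[of n]] by (auto simp: closure_of_subtopology F_def)
  qed
  obtain C h where h: "clopenin X C" "homeomorphic_map (subtopology X F) (subtopology X C) h" "h ` F = C"
    by (rule CO_space_copy[OF CO F])
  obtain c' P' where "system X (h ` E) c' P' (h ` {b})"
    by (rule system_copy[OF S F refl _ h(1,2)]) (auto simp: F_def)
  then show False
    by (rule no_nontrivial_system) simp
qed

end

section \<open>Ends of copies in a CO space\<close>

text \<open>The space \<open>Y\<close> provides an index over \<open>'a\<close> for the rank of
  \<open>L\<close>, whose own rank is indexed over \<open>'b\<close>.\<close>

lemma CO_space_finitely_many_ends:
  fixes X :: "'a topology" and L :: "'b topology" and M :: "'c topology"
  assumes X: "scattered_compact X" and CO: "CO_space X"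
    and SH: "\<And>S. S \<subseteq> topspace X \<Longrightarrow> infinite S \<Longrightarrow> regularCard |S| \<Longrightarrow>
      \<exists>D V. D \<subseteq> S \<and> |D| =o |S| \<and> clopen_strong_Hausdorff_system X D V"
    and prec: "precedes M L" and Y: "almost_homeomorphic (Y :: 'a topology) L"
  shows "finite {x. \<exists>\<Lambda>. closedin X \<Lambda> \<and> germ (subtopology X \<Lambda>) x L (end_point L)}"
proof -
  obtain N where N: "N \<subseteq> topspace L" "almost_homeomorphic (subtopology L N) M" and M: "unitary M" "unitary L"
    and ne: "\<not> almost_homeomorphic M L" and rk: "cb_rank_ord M =o cb_rank_ord L"
    using prec unfolding precedes_def by blast
  have uN: "unitary (subtopology L N)" and uY: "unitary Y"
    using N(2) Y by (auto simp: almost_homeomorphic_def)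
  note L' = unitary_cb_iter[OF M(2)] and N' = unitary_cb_iter[OF uN] and Y' = unitary_cb_iter[OF uY]
  have "cb_rank_ord (subtopology L N) =o cb_rank_ord L"
    using almost_homeomorphic_germ(2)[OF N(2)] rk by (rule ordIso_transitive)
  then have rkN: "cb_rank (subtopology L N) = cb_rank L"
    unfolding cb_rank_ord_def by (rule Restr_underS_eq[OF ords_Well_order N'(3) L'(3)])
  \<comment> \<open>\<open>precedes\<close> does not ask that the copy of \<open>M\<close> share the
    end of \<open>L\<close>; equal ranks force it, since the last stage of a subspace lies in the
    same stage of \<open>L\<close>.\<close>
  have "cb_level (subtopology L N) (cb_rank L) \<subseteq> cb_level (subtopology L (topspace L)) (cb_rank L)"
    by (rule cb_iter_mono[OF ords_Well_order L'(3) N(1)])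
  then have endN: "end_point (subtopology L N) = end_point L"
    using N'(1) L'(1) rkN by simp
  have "compactin L N"
    using N'(4) N(1) by (simp add: scattered_compact_def compactin_subspace)
  then have clN: "closedin L N"
    using L'(4) compactin_imp_closedin by (auto simp: scattered_compact_def)
  have diff: "\<not> germ (subtopology L N) (end_point L) L (end_point L)"
  proof
    assume g: "germ (subtopology L N) (end_point L) L (end_point L)"
    have "germ M (end_point M) (subtopology L N) (end_point L)"
      using germ_sym[OF almost_homeomorphic_germ(1)[OF N(2)]] endN by simp
    from germ_almost_homeomorphic[OF M germ_trans[OF this g]] ne show False by simp
  qed
  interpret CO_germ_pair L N "end_point L" "cb_rank L" "cb_rank Y" X
    using L' N' Y' rkN endN clN diff X CO SH almost_homeomorphic_germ(2)[OF Y]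
    by unfold_locales (auto simp: cb_rank_ord_def)
  show ?thesis by (rule finitely_many_closed_germs)
qed

text \<open>The closed sets are cut down to disjoint clopen neighbourhoods of their points, so their
  union can be copied in one go. Because the image is clopen, each point acquires in
  \<open>X\<close> the germ it had in its closed set; closed subsets through the point are carried
  along.\<close>

lemma CO_space_germ_copies:
  assumes X: "scattered_compact X" and CO: "CO_space X" and Z: "finite Z"
    and \<Lambda>: "\<And>z. z \<in> Z \<Longrightarrow> closedin X (\<Lambda> z)" "\<And>z. z \<in> Z \<Longrightarrow> z \<in> \<Lambda> z"
  obtains h where "inj_on h Z" "\<And>z. z \<in> Z \<Longrightarrow> germ (subtopology X (\<Lambda> z)) z X (h z)"
    "\<And>z T. z \<in> Z \<Longrightarrow> T \<subseteq> \<Lambda> z \<Longrightarrow> closedin X T \<Longrightarrow> z \<in> T \<Longrightarrow>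
      \<exists>T'. closedin X T' \<and> germ (subtopology X T) z (subtopology X T') (h z)"
proof -
  have "Z \<subseteq> topspace X" using \<Lambda> closedin_subset by blast
  then obtain W where W: "\<And>z. z \<in> Z \<Longrightarrow> clopenin X (W z)" "\<And>z. z \<in> Z \<Longrightarrow> z \<in> W z" "disjoint_family_on W Z"
    by (rule finite_disjoint_clopen[OF X Z]) (rule that)
  define F where "F = (\<Union>z\<in>Z. \<Lambda> z \<inter> W z)"
  have F: "closedin X F"
    unfolding F_def using Z \<Lambda>(1) W(1) by (intro closedin_Union) (auto simp: clopenin_def)
  obtain C h where h: "clopenin X C" "homeomorphic_map (subtopology X F) (subtopology X C) h" "h ` F = C"
    by (rule CO_space_copy[OF CO F])
  have t: "topspace (subtopology X F) = F"
    using closedin_subset[OF F] by (simp add: inf_absorb2)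
  have ZF: "z \<in> F" if "z \<in> Z" for z using that \<Lambda>(2) W(2) by (auto simp: F_def)
  have inj: "inj_on h F" using homeomorphic_imp_injective_map[OF h(2)] t by simp
  show ?thesis
  proof (rule that[of h])
    show "inj_on h Z" using inj by (rule inj_on_subset) (use ZF in blast)
  next
    fix z assume z: "z \<in> Z"
    let ?U = "\<Lambda> z \<inter> W z"
    have "?U = F \<inter> W z"
      using W(3) z by (fastforce simp: F_def disjoint_family_on_def)
    moreover have oW: "openin X (W z)" using W(1)[OF z] by (simp add: clopenin_def)
    ultimately have "openin (subtopology X F) ?U"
      by (simp add: openin_subtopology_Int2)
    then have 1: "germ (subtopology X ?U) z (subtopology X F) z"
      using z \<Lambda>(2) W(2) by (intro germ_open_subtopology) auto
    have 2: "germ (subtopology X ?U) z (subtopology X (\<Lambda> z)) z"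
      using openin_subtopology_Int2[OF oW, of "\<Lambda> z"] z \<Lambda>(2) W(2) by (intro germ_open_subtopology) auto
    have 3: "germ (subtopology X F) z (subtopology X C) (h z)"
      by (rule germ_homeomorphic_map[OF h(2)]) (use t ZF[OF z] in simp)
    have 4: "germ (subtopology X C) (h z) X (h z)"
      using h(1,3) ZF[OF z] by (intro germ_open) (auto simp: clopenin_def)
    show "germ (subtopology X (\<Lambda> z)) z X (h z)"
      by (rule germ_trans[OF germ_sym[OF 2] germ_trans[OF 1 germ_trans[OF 3 4]]])
  next
    fix z T assume z: "z \<in> Z" and T: "T \<subseteq> \<Lambda> z" "closedin X T" "z \<in> T"
    let ?T = "T \<inter> W z"
    have TF: "?T \<subseteq> F" using T(1) z by (auto simp: F_def)
    have "closedin X ?T" using T(2) W(1)[OF z] by (auto simp: clopenin_def)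
    then have "closedin (subtopology X F) ?T" using TF by (rule closedin_subset_topspace)
    then have "closedin (subtopology X C) (h ` ?T)"
      using homeomorphic_map_closedness_eq[OF h(2)] by blast
    then have cl: "closedin X (h ` ?T)"
      using h(1) closedin_trans_full by (auto simp: clopenin_def)
    have "homeomorphic_map (subtopology X ?T) (subtopology X (h ` ?T)) h"
      by (rule homeomorphic_map_subtopology_image(1)[OF h(2) closedin_subset[OF F] clopenin_subset[OF h(1)] TF])
    then have 1: "germ (subtopology X ?T) z (subtopology X (h ` ?T)) (h z)"
      using T(3) W(2)[OF z] closedin_subset[OF T(2)] by (intro germ_homeomorphic_map) auto
    have "openin X (W z)" using W(1)[OF z] by (simp add: clopenin_def)
    then have 2: "germ (subtopology X ?T) z (subtopology X T) z"
      using openin_subtopology_Int2 T(3) W(2)[OF z] by (intro germ_open_subtopology) auto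
    show "\<exists>T'. closedin X T' \<and> germ (subtopology X T) z (subtopology X T') (h z)"
      using cl germ_trans[OF germ_sym[OF 2] 1] by blast
  qed
qed

text \<open>If \<open>L\<close> had finitely many ends in \<open>X\<close>, copying them onto a clopen set would show that each has a
  clopen neighbourhood of type \<open>L\<close>. But a clopen copy of \<open>K\<close> has its end among them.\<close>

lemma weakly_precedes_infinitely_many_ends:
  fixes X :: "'a topology" and L :: "'b topology"
  assumes X: "scattered_compact X" and CO: "CO_space X" and K: "K \<subseteq> topspace X"
    and LK: "weakly_precedes L (subtopology X K)"
  shows "infinite {x. \<exists>\<Lambda>. closedin X \<Lambda> \<and> germ (subtopology X \<Lambda>) x L (end_point L)}" (is "infinite ?Z")
    "\<exists>Y :: 'a topology. almost_homeomorphic Y L"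
proof -
  obtain K' where K': "K' \<subseteq> K" "almost_homeomorphic (subtopology X K') L" 
    "end_point (subtopology X K') = end_point (subtopology X K)"
    and uK: "unitary (subtopology X K)" and uL: "unitary L" and ne: "\<not> almost_homeomorphic L (subtopology X K)"
    using LK unfolding weakly_precedes_def by (auto simp: subtopology_subtopology inf_absorb2)
  show "\<exists>Y :: 'a topology. almost_homeomorphic Y L" using K'(2) by blast
  have unitary_closed: "closedin X A" if "unitary (subtopology X A)" "A \<subseteq> topspace X" for A
  proof -
    have "compactin X A"
      using unitary_cb_iter(4)[OF that(1)] that(2) by (simp add: scattered_compact_def compactin_subspace)
    then show ?thesis using X compactin_imp_closedin by (auto simp: scattered_compact_def)
  qed
  let ?k = "end_point (subtopology X K)"
  have clK: "closedin X K" by (rule unitary_closed[OF uK K])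
  have clK': "closedin X K'"
    using K'(1,2) K by (intro unitary_closed) (auto simp: almost_homeomorphic_def)
  have gK': "germ (subtopology X K') ?k L (end_point L)"
    using almost_homeomorphic_germ(1)[OF K'(2)] K'(3) by simp
  have kK': "?k \<in> K'" using germ_topspace(1)[OF gK'] by simp
  show "infinite ?Z"
  proof
    define Z where "Z = ?Z"
    assume "finite ?Z"
    then have fin: "finite Z" by (simp add: Z_def)
    have ZI: "x \<in> Z" if "closedin X \<Lambda>" "germ (subtopology X \<Lambda>) x L (end_point L)" for x \<Lambda>
      using that by (auto simp: Z_def)
    have "\<forall>z\<in>Z. \<exists>\<Lambda>. closedin X \<Lambda> \<and> germ (subtopology X \<Lambda>) z L (end_point L)" by (simp add: Z_def)
    from bchoice[OF this] obtain \<Lambda> where \<Lambda>: "\<And>z. z \<in> Z \<Longrightarrow> closedin X (\<Lambda> z)" 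
      "\<And>z. z \<in> Z \<Longrightarrow> germ (subtopology X (\<Lambda> z)) z L (end_point L)" by blast
    have z\<Lambda>: "z \<in> \<Lambda> z" if "z \<in> Z" for z
      using germ_topspace(1)[OF \<Lambda>(2)[OF that]] by simp
    obtain h where h: "inj_on h Z" "\<And>z. z \<in> Z \<Longrightarrow> germ (subtopology X (\<Lambda> z)) z X (h z)"
      "\<And>z T. z \<in> Z \<Longrightarrow> T \<subseteq> \<Lambda> z \<Longrightarrow> closedin X T \<Longrightarrow> z \<in> T \<Longrightarrow>
        \<exists>T'. closedin X T' \<and> germ (subtopology X T) z (subtopology X T') (h z)"
      by (rule CO_space_germ_copies[OF X CO fin \<Lambda>(1) z\<Lambda>]) (assumption | rule that)+
    have "h ` Z \<subseteq> Z"
    proof (rule image_subsetI)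
      fix z assume z: "z \<in> Z"
      obtain T' where T': "closedin X T'" "germ (subtopology X (\<Lambda> z)) z (subtopology X T') (h z)"
        using h(3)[OF z subset_refl \<Lambda>(1)[OF z] z\<Lambda>[OF z]] by blast
      from ZI[OF T'(1) germ_trans[OF germ_sym[OF T'(2)] \<Lambda>(2)[OF z]]] show "h z \<in> Z" .
    qed
    then have hZ: "h ` Z = Z" using fin h(1) by (simp add: endo_inj_surj)
    have gX: "germ X z L (end_point L)" if "z \<in> Z" for z
    proof -
      have "z \<in> h ` Z" unfolding hZ by (rule that)
      then obtain z0 where z0: "z = h z0" "z0 \<in> Z" by (rule imageE)
      show ?thesis
        unfolding z0(1) by (rule germ_trans[OF germ_sym[OF h(2)[OF z0(2)]] \<Lambda>(2)[OF z0(2)]])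
    qed
    obtain g where g: "germ (subtopology X K) ?k X (g ?k)"
      "\<And>T. T \<subseteq> K \<Longrightarrow> closedin X T \<Longrightarrow> ?k \<in> T \<Longrightarrow> \<exists>T'. closedin X T' \<and> germ (subtopology X T) ?k (subtopology X T') (g ?k)"
      by (rule CO_space_germ_copies[OF X CO, of "{?k}" "\<lambda>_. K"]) (use clK kK' K'(1) in auto)
    obtain T' where T': "closedin X T'" "germ (subtopology X K') ?k (subtopology X T') (g ?k)"
      using g(2)[OF K'(1) clK' kK'] by blast
    have "g ?k \<in> Z"
      by (rule ZI[OF T'(1) germ_trans[OF germ_sym[OF T'(2)] gK']])
    \<comment> \<open>At \<open>g ?k\<close> the space \<open>X\<close> has the germ of
      \<open>L\<close>, as at every point of \<open>Z\<close>, and also that of the copied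
      \<open>K\<close>.\<close>
    from germ_trans[OF germ_sym[OF gX[OF this]] germ_sym[OF g(1)]]
    have "germ L (end_point L) (subtopology X K) ?k" .
    with germ_almost_homeomorphic[OF uL uK] ne show False by simp
  qed
qed

theorem theorem4p2:
  fixes X :: "'a topology"
  assumes "scattered_compact X"
    and "\<And>S. S \<subseteq> topspace X \<Longrightarrow> infinite S \<Longrightarrow> regularCard |S| \<Longrightarrow>
      \<exists>D V. D \<subseteq> S \<and> |D| =o |S| \<and> clopen_strong_Hausdorff_system X D V"
  shows
    "((\<exists>(L :: 'b topology) (M :: 'c topology) (Li :: nat \<Rightarrow> 'a set).
         unitary L \<and> unitary M \<and> precedes M L \<and> (\<forall>i. Li i \<subseteq> topspace X) \<and>
         (\<forall>i j. i < j \<longrightarrow> almost_homeomorphic (subtopology X (Li i)) L \<and>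
            end_point (subtopology X (Li i)) \<noteq> end_point (subtopology X (Li j))))
       \<longrightarrow> \<not> CO_space X) \<and>
     ((\<exists>(K :: 'a set) (L :: 'd topology) (M :: 'e topology).
         K \<subseteq> topspace X \<and> unitary (subtopology X K) \<and> unitary L \<and> unitary M \<and>
         precedes M L \<and> weakly_precedes L (subtopology X K))
       \<longrightarrow> \<not> CO_space X)"
proof (intro conjI impI notI; elim exE conjE)
  fix L :: "'b topology" and M :: "'c topology" and Li :: "nat \<Rightarrow> 'a set"
  assume CO: "CO_space X" and prec: "precedes M L" and Li: "\<forall>i. Li i \<subseteq> topspace X"
    "\<forall>i j. i < j \<longrightarrow> almost_homeomorphic (subtopology X (Li i)) L \<and>
       end_point (subtopology X (Li i)) \<noteq> end_point (subtopology X (Li j))"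
  let ?e = "\<lambda>i. end_point (subtopology X (Li i))"
  \<comment> \<open>The hypothesis speaks of \<open>i\<close> only together with a larger index;
    \<open>Suc i\<close> serves.\<close>
  have almost: "almost_homeomorphic (subtopology X (Li i)) L" for i
    using Li(2) lessI by blast
  have "?e i \<in> {x. \<exists>\<Lambda>. closedin X \<Lambda> \<and> germ (subtopology X \<Lambda>) x L (end_point L)}" for i
  proof -
    have "unitary (subtopology X (Li i))" using almost by (auto simp: almost_homeomorphic_def)
    then have "compactin X (Li i)"
      using unitary_cb_iter(4) Li(1) by (auto simp: scattered_compact_def compactin_subspace)
    then have "closedin X (Li i)"
      using assms(1) compactin_imp_closedin by (auto simp: scattered_compact_def)
    with almost_homeomorphic_germ(1)[OF almost] show ?thesis by blast
  qed
  then have "range ?e \<subseteq> {x. \<exists>\<Lambda>. closedin X \<Lambda> \<and> germ (subtopology X \<Lambda>) x L (end_point L)}" by blast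
  then have "finite (range ?e)"
    using CO_space_finitely_many_ends[OF assms(1) CO assms(2) prec almost] by (rule finite_subset)
  moreover have "inj ?e"
  proof (rule injI, rule ccontr)
    fix i j assume "?e i = ?e j" "i \<noteq> j"
    then show False using Li(2) by (metis nat_neq_iff)
  qed
  ultimately show False by (simp add: finite_image_iff)
next
  fix K :: "'a set" and L :: "'d topology" and M :: "'e topology"
  assume CO: "CO_space X" and K: "K \<subseteq> topspace X" and prec: "precedes M L" 
    and LK: "weakly_precedes L (subtopology X K)"
  obtain Y :: "'a topology" where Y: "almost_homeomorphic Y L"
    using weakly_precedes_infinitely_many_ends(2)[OF assms(1) CO K LK] by blast
  show False
    using CO_space_finitely_many_ends[OF assms(1) CO assms(2) prec Y]
      weakly_precedes_infinitely_many_ends(1)[OF assms(1) CO K LK] by simp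
qed

end
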